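(* For each of the uncertainty sets $\mathcal D(\varepsilon)\in\{\mathcal D^{\mathrm{S},\infty}(\varepsilon),\ \mathcal D^{\mathrm{S},1}(\varepsilon),\ \mathcal D^{\mathrm{L},1}(\varepsilon)\}$, the diffusion-robust traveling salesman problem Diff-RTSP, $$\mathrm{OPT}_{\mathrm{RTSP}}(w,\mathcal D(\varepsilon))=\min_{H\in\mathcal H}\ \max_{(\Delta^+,\Delta^-)\in\mathcal D(\varepsilon)}\ \sum_{e\in H}\bigl(w_e+\Delta^+_e-\Delta^-_e\bigr),$$ is polynomial-time equivalent to ordinary TSP. In particular, ordinary TSP is recovered as the special case $\varepsilon=0$, and for each of the three uncertainty sets above, Diff-RTSP can be reduced in polynomial time to ordinary TSP.
   Context: $G=(V,E)$ is a complete directed graph (one edge for each ordered pair of distinct vertices) with weights $w\in\mathbb{R}^E_{\ge0}$, and $\varepsilon\ge0$ is part of the input. $\mathcal H$ is the set of Hamiltonian cycles of $G$ (directed cycles visiting every vertex exactly once), identified with their edge sets. Ordinary TSP with weights $w$ is the problem $\mathrm{OPT}(w)=\min_{H\in\mathcal H}\sum_{e\in H}w_e$. For $u\in V$, $E_{\mathrm{in}}(u)$ and $E_{\mathrm{out}}(u)$ are the edges entering/leaving $u$. A pair $(\Delta^+,\Delta^-)\in\mathbb{R}^{E}_{\ge0}\times\mathbb{R}^{E}_{\ge0}$ satisfies conservation if $\sum_{e\in E_{\mathrm{in}}(u)}\Delta^-_e=\sum_{e\in E_{\mathrm{out}}(u)}\Delta^+_e$ for all $u\in V$. For $p\in\{1,\infty\}$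 (entrywise inequalities; $\|\cdot\|_p$ the standard norm of the concatenated vector): - $\mathcal D^{\mathrm{S},p}(\varepsilon)$ is the set of such pairs satisfying conservation, $\Delta^-\le w$, and $\|(\Delta^+,\Delta^-)\|_p\le\varepsilon$; - $\mathcal D^{\mathrm{L},p}(\varepsilon)$ is the set of such pairs satisfying conservation, $\Delta^-\le w+\Delta^+$, and $\|(\Delta^+,\Delta^-)\|_p\le\varepsilon$. *)

theory Defs
  imports
    Complex_Main
    "HOL-Library.Log_Nat"
    "HOL-Computational_Algebra.Polynomial"
    "Graph_Theory.Graph_Theory"
begin

section \<open>Hamiltonian cycles and the two problems\<close>

text \<open>A cycle repeats no vertex, so it is Hamiltonian iff it covers all vertices. Cycles are
  identified with their edge sets.\<close>

definition ham_cycles :: "('v, 'e) pre_digraph \<Rightarrow> 'e set set" where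
  "ham_cycles G = {set p | p. pre_digraph.cycle G p \<and> tail G ` set p = verts G}"

definition tsp_opt :: "('v, 'e) pre_digraph \<Rightarrow> ('e \<Rightarrow> real) \<Rightarrow> real" where
  "tsp_opt G w = Min ((\<lambda>H. \<Sum>e\<in>H. w e) ` ham_cycles G)"

datatype variant = Variant_S | Variant_L
datatype norm_kind = Norm_1 | Norm_Inf

fun pair_norm :: "norm_kind \<Rightarrow> 'e set \<Rightarrow> ('e \<Rightarrow> real) \<times> ('e \<Rightarrow> real) \<Rightarrow> real" where
  "pair_norm Norm_1 E (dp, dm) = (\<Sum>e\<in>E. \<bar>dp e\<bar>) + (\<Sum>e\<in>E. \<bar>dm e\<bar>)"
| "pair_norm Norm_Inf E (dp, dm) = Max (insert 0 ((\<lambda>e. \<bar>dp e\<bar>) ` E \<union> (\<lambda>e. \<bar>dm e\<bar>) ` E))"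

fun decrease_cap :: "variant \<Rightarrow> ('e \<Rightarrow> real) \<Rightarrow> ('e \<Rightarrow> real) \<Rightarrow> 'e \<Rightarrow> real" where
  "decrease_cap Variant_S w dp e = w e"
| "decrease_cap Variant_L w dp e = w e + dp e"

text \<open>Vectors in \<open>\<real>\<^sup>E\<close> are functions; only their values on \<open>arcs G\<close> matter.\<close>

definition uncertainty_set ::
  "variant \<Rightarrow> norm_kind \<Rightarrow> ('v, 'e) pre_digraph \<Rightarrow> ('e \<Rightarrow> real) \<Rightarrow> real
     \<Rightarrow> (('e \<Rightarrow> real) \<times> ('e \<Rightarrow> real)) set" where
  "uncertainty_set a p G w \<epsilon> = {(dp, dm).
     (\<forall>e\<in>arcs G. 0 \<le> dp e \<and> 0 \<le> dm e) \<and>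
     (\<forall>u\<in>verts G. (\<Sum>e\<in>in_arcs G u. dm e) = (\<Sum>e\<in>out_arcs G u. dp e)) \<and>
     (\<forall>e\<in>arcs G. dm e \<le> decrease_cap a w dp e) \<and>
     pair_norm p (arcs G) (dp, dm) \<le> \<epsilon>}"

text \<open>\<open>GREATEST\<close> is the maximum in the literal sense: it is only determined if it is attained.\<close>

definition worst_cost ::
  "('e \<Rightarrow> real) \<Rightarrow> (('e \<Rightarrow> real) \<times> ('e \<Rightarrow> real)) set \<Rightarrow> 'e set \<Rightarrow> real" where
  "worst_cost w D H =
     (GREATEST c. \<exists>(dp, dm)\<in>D. c = (\<Sum>e\<in>H. w e + dp e - dm e))"

definition rtsp_opt ::
  "('v, 'e) pre_digraph \<Rightarrow> ('e \<Rightarrow> real) \<Rightarrow> (('e \<Rightarrow> real) \<times> ('e \<Rightarrow> real)) set \<Rightarrow> real" where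
  "rtsp_opt G w D = Min (worst_cost w D ` ham_cycles G)"


section \<open>Polynomial time\<close>

text \<open>
  The machine is a random access machine, programmed by while programs, whose memory consists of
  arrays of natural numbers (for indices and combinatorial data) and arrays of real numbers.
  The running time is parameterised by the cost \<open>sz r\<close> of handling a real number \<open>r\<close>;
  natural numbers are always charged by their binary length (logarithmic cost criterion).
  With \<open>sz = unit_size\<close> this is the real RAM, which counts arithmetic operations.
  With \<open>sz = bit_size\<close> and rational data it is the logarithmic cost RAM, which is polynomially
  equivalent to Turing machines working on binary encodings.
\<close>

type_synonym state = "(nat \<Rightarrow> nat \<Rightarrow> nat) \<times> (nat \<Rightarrow> nat \<Rightarrow> real)"

datatype iexp =
  IConst nat | IArr nat iexp | IAdd iexp iexp | ISub iexp iexp | IMul iexp iexp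

datatype rexp =
  RConst rat | RArr nat iexp | RAdd rexp rexp | RSub rexp rexp | RMul rexp rexp | RDiv rexp rexp

datatype test = ILess iexp iexp | RLess rexp rexp

datatype com =
    Skip
  | IAssign nat iexp iexp  \<comment> \<open>\<open>IAssign a i e\<close>: cell \<open>i\<close> of integer array \<open>a\<close> becomes \<open>e\<close>\<close>
  | RAssign nat iexp rexp
  | Seq com com
  | If test com com
  | While test com

primrec ival :: "iexp \<Rightarrow> state \<Rightarrow> nat" where
  "ival (IConst n) s = n"
| "ival (IArr a i) s = fst s a (ival i s)"
| "ival (IAdd e f) s = ival e s + ival f s"
| "ival (ISub e f) s = ival e s - ival f s"
| "ival (IMul e f) s = ival e s * ival f s"

primrec rval :: "rexp \<Rightarrow> state \<Rightarrow> real" where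
  "rval (RConst q) s = of_rat q"
| "rval (RArr a i) s = snd s a (ival i s)"
| "rval (RAdd e f) s = rval e s + rval f s"
| "rval (RSub e f) s = rval e s - rval f s"
| "rval (RMul e f) s = rval e s * rval f s"
| "rval (RDiv e f) s = rval e s / rval f s"

primrec tval :: "test \<Rightarrow> state \<Rightarrow> bool" where
  "tval (ILess e f) s = (ival e s < ival f s)"
| "tval (RLess e f) s = (rval e s < rval f s)"

definition nat_size :: "nat \<Rightarrow> nat" where
  "nat_size n = floorlog 2 n"

definition unit_size :: "real \<Rightarrow> nat" where
  "unit_size r = 0"

text \<open>Binary length of numerator and denominator; only meaningful for rational arguments.\<close>

definition bit_size :: "real \<Rightarrow> nat" where
  "bit_size r = (let (a, b) = quotient_of (the_inv (of_rat :: rat \<Rightarrow> real) r)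
                 in nat_size (nat \<bar>a\<bar>) + nat_size (nat b))"

text \<open>Every node of an expression costs one step plus the size of its value.\<close>

primrec icost :: "iexp \<Rightarrow> state \<Rightarrow> nat" where
  "icost (IConst n) s = 1 + nat_size n"
| "icost (IArr a i) s = 1 + nat_size (ival (IArr a i) s) + icost i s"
| "icost (IAdd e f) s = 1 + nat_size (ival (IAdd e f) s) + icost e s + icost f s"
| "icost (ISub e f) s = 1 + nat_size (ival (ISub e f) s) + icost e s + icost f s"
| "icost (IMul e f) s = 1 + nat_size (ival (IMul e f) s) + icost e s + icost f s"

primrec rcost :: "(real \<Rightarrow> nat) \<Rightarrow> rexp \<Rightarrow> state \<Rightarrow> nat" where
  "rcost sz (RConst q) s = 1 + sz (of_rat q)"
| "rcost sz (RArr a i) s = 1 + sz (rval (RArr a i) s) + icost i s"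
| "rcost sz (RAdd e f) s = 1 + sz (rval (RAdd e f) s) + rcost sz e s + rcost sz f s"
| "rcost sz (RSub e f) s = 1 + sz (rval (RSub e f) s) + rcost sz e s + rcost sz f s"
| "rcost sz (RMul e f) s = 1 + sz (rval (RMul e f) s) + rcost sz e s + rcost sz f s"
| "rcost sz (RDiv e f) s = 1 + sz (rval (RDiv e f) s) + rcost sz e s + rcost sz f s"

primrec tcost :: "(real \<Rightarrow> nat) \<Rightarrow> test \<Rightarrow> state \<Rightarrow> nat" where
  "tcost sz (ILess e f) s = 1 + icost e s + icost f s"
| "tcost sz (RLess e f) s = 1 + rcost sz e s + rcost sz f s"

definition iupd :: "nat \<Rightarrow> nat \<Rightarrow> nat \<Rightarrow> state \<Rightarrow> state" where
  "iupd a i x s = ((fst s)(a := (fst s a)(i := x)), snd s)"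

definition rupd :: "nat \<Rightarrow> nat \<Rightarrow> real \<Rightarrow> state \<Rightarrow> state" where
  "rupd a i x s = (fst s, (snd s)(a := (snd s a)(i := x)))"

text \<open>\<open>exec sz c s k t\<close>: program \<open>c\<close> started in \<open>s\<close> halts in \<open>t\<close> after time \<open>k\<close>.\<close>

inductive exec :: "(real \<Rightarrow> nat) \<Rightarrow> com \<Rightarrow> state \<Rightarrow> nat \<Rightarrow> state \<Rightarrow> bool"
  for sz :: "real \<Rightarrow> nat" where
  Skip: "exec sz Skip s 1 s"
| IAssign: "exec sz (IAssign a i e) s (1 + icost i s + icost e s) (iupd a (ival i s) (ival e s) s)"
| RAssign: "exec sz (RAssign a i e) s (1 + icost i s + rcost sz e s) (rupd a (ival i s) (rval e s) s)"
| Seq: "exec sz c s k t \<Longrightarrow> exec sz d t l u \<Longrightarrow> exec sz (Seq c d) s (k + l) u"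
| IfTrue: "tval b s \<Longrightarrow> exec sz c s k t \<Longrightarrow> exec sz (If b c d) s (tcost sz b s + k) t"
| IfFalse: "\<not> tval b s \<Longrightarrow> exec sz d s k t \<Longrightarrow> exec sz (If b c d) s (tcost sz b s + k) t"
| WhileFalse: "\<not> tval b s \<Longrightarrow> exec sz (While b c) s (tcost sz b s) s"
| WhileTrue: "tval b s \<Longrightarrow> exec sz c s k t \<Longrightarrow> exec sz (While b c) t l u \<Longrightarrow>
    exec sz (While b c) s (tcost sz b s + k + l) u"

text \<open>Inputs and outputs are pairs of a word of naturals and a word of reals. They are held in
  integer array 0 and real array 0; their lengths are in cells 0 and 1 of integer array 1.
  All other cells are initially 0.\<close>

type_synonym data = "nat list \<times> real list"

definition load :: "data \<Rightarrow> state" where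
  "load x =
     (\<lambda>a i. if a = 0 then (if i < length (fst x) then fst x ! i else 0)
            else if a = 1 \<and> i = 0 then length (fst x)
            else if a = 1 \<and> i = 1 then length (snd x) else 0,
      \<lambda>a i. if a = 0 \<and> i < length (snd x) then snd x ! i else 0)"

definition unload :: "state \<Rightarrow> data" where
  "unload s = (map (fst s 0) [0..<fst s 1 0], map (snd s 0) [0..<fst s 1 1])"

definition data_size :: "(real \<Rightarrow> nat) \<Rightarrow> data \<Rightarrow> nat" where
  "data_size sz x = (\<Sum>n\<leftarrow>fst x. 1 + nat_size n) + (\<Sum>r\<leftarrow>snd x. 1 + sz r)"

definition data_append :: "data \<Rightarrow> data \<Rightarrow> data" where
  "data_append x y = (fst x @ fst y, snd x @ snd y)"

text \<open>Writing the output is charged as well; otherwise a long output could be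
  announced cheaply through the length cells.\<close>

definition computes_within ::
  "(real \<Rightarrow> nat) \<Rightarrow> com \<Rightarrow> data \<Rightarrow> data \<Rightarrow> nat \<Rightarrow> bool" where
  "computes_within sz c x y b \<longleftrightarrow>
     (\<exists>k t. exec sz c (load x) k t \<and> unload t = y \<and> k + data_size sz y \<le> b)"

text \<open>One program turns \<open>inp x\<close> into \<open>out x\<close> for all \<open>x \<in> X\<close>, in polynomial time both
  as a real RAM on arbitrary real data and in the bit model on rational data.\<close>

definition poly_time :: "'x set \<Rightarrow> ('x \<Rightarrow> data) \<Rightarrow> ('x \<Rightarrow> data) \<Rightarrow> bool" where
  "poly_time X inp out \<longleftrightarrow> (\<exists>c. \<exists>q :: nat poly. \<forall>x\<in>X.
     computes_within unit_size c (inp x) (out x) (poly q (data_size unit_size (inp x))) \<and>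
     (set (snd (inp x)) \<subseteq> \<rat> \<longrightarrow>
        computes_within bit_size c (inp x) (out x) (poly q (data_size bit_size (inp x)))))"


section \<open>Minimisation problems and polynomial-time reductions\<close>

text \<open>\<open>sol_words s\<close> is the set of words that represent the solution \<open>s\<close>.\<close>

record ('i, 's) min_problem =
  instances :: "'i set"
  encode :: "'i \<Rightarrow> data"
  solutions :: "'i \<Rightarrow> 's set"
  objective :: "'i \<Rightarrow> 's \<Rightarrow> real"
  sol_words :: "'s \<Rightarrow> nat list set"

definition optimum :: "('i, 's) min_problem \<Rightarrow> 'i \<Rightarrow> real" where
  "optimum P x = Min (objective P x ` solutions P x)"

definition optimal :: "('i, 's) min_problem \<Rightarrow> 'i \<Rightarrow> 's \<Rightarrow> bool" where
  "optimal P x s \<longleftrightarrow> s \<in> solutions P x \<and> (\<forall>s'\<in>solutions P x. objective P x s \<le> objective P x s')"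

text \<open>A reduction maps instances of \<open>P\<close> to instances of \<open>Q\<close> such that, from the instance of \<open>P\<close>
  together with the optimal value (an optimal solution) of its image, the optimal value
  (an optimal solution) of the original instance can be recovered; all in polynomial time.\<close>

definition reducible :: "('i, 's) min_problem \<Rightarrow> ('j, 't) min_problem \<Rightarrow> bool" where
  "reducible P Q \<longleftrightarrow> (\<exists>f g.
     (\<forall>x\<in>instances P. f x \<in> instances Q) \<and>
     poly_time (instances P) (encode P) (\<lambda>x. encode Q (f x)) \<and>
     poly_time (instances P)
       (\<lambda>x. data_append (encode P x) ([], [optimum Q (f x)])) (\<lambda>x. ([], [optimum P x])) \<and>
     (\<forall>x\<in>instances P. \<forall>t. \<forall>v\<in>sol_words Q t. optimal Q (f x) t \<longrightarrow>
        (\<exists>s. optimal P x s \<and> g x v \<in> sol_words P s)) \<and>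
     poly_time {(x, v). x \<in> instances P \<and> (\<exists>t. optimal Q (f x) t \<and> v \<in> sol_words Q t)}
       (\<lambda>(x, v). data_append (encode P x) (v, [])) (\<lambda>(x, v). (g x v, [])))"

definition poly_time_equivalent :: "('i, 's) min_problem \<Rightarrow> ('j, 't) min_problem \<Rightarrow> bool" where
  "poly_time_equivalent P Q \<longleftrightarrow> reducible P Q \<and> reducible Q P"


section \<open>TSP and Diff-RTSP as computational problems\<close>

definition complete_on :: "nat \<Rightarrow> (nat, nat \<times> nat) pre_digraph" where
  "complete_on n = \<lparr>verts = {..<n}, arcs = {(u, v). u < n \<and> v < n \<and> u \<noteq> v}, tail = fst, head = snd\<rparr>"

lemma complete_digraph_complete_on: "complete_digraph n (complete_on n)"
proof -
  have "finite {(u, v). u < n \<and> v < n \<and> u \<noteq> v}"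
    by (rule finite_subset[of _ "{..<n} \<times> {..<n}"]) auto
  then have "graph (complete_on n)"
    by unfold_locales
      (auto simp: complete_on_def arc_to_ends_def symmetric_def arcs_ends_def sym_def image_iff)
  then show ?thesis
    by (auto simp: complete_digraph_def complete_on_def arcs_ends_def arc_to_ends_def image_iff)
qed

definition weights_ok :: "nat \<Rightarrow> (nat \<times> nat \<Rightarrow> real) \<Rightarrow> bool" where
  "weights_ok n w \<longleftrightarrow> (\<forall>e\<in>arcs (complete_on n). 0 \<le> w e)"

text \<open>Weights are given as an adjacency matrix in row-major order; the diagonal, where there are
  no edges, is filled with 0.\<close>

definition weight_matrix :: "nat \<Rightarrow> (nat \<times> nat \<Rightarrow> real) \<Rightarrow> real list" where
  "weight_matrix n w = [if u = v then 0 else w (u, v). u \<leftarrow> [0..<n], v \<leftarrow> [0..<n]]"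

text \<open>An edge set is represented by any list of its edges.\<close>

definition edge_words :: "(nat \<times> nat) set \<Rightarrow> nat list set" where
  "edge_words H = {concat (map (\<lambda>(u, v). [u, v]) es) | es. distinct es \<and> set es = H}"

text \<open>For \<open>n < 2\<close> there is no Hamiltonian cycle and the minimum is undefined.\<close>

definition TSP :: "(nat \<times> (nat \<times> nat \<Rightarrow> real), (nat \<times> nat) set) min_problem" where
  "TSP = \<lparr>instances = {(n, w). 2 \<le> n \<and> weights_ok n w},
     encode = (\<lambda>(n, w). ([n], weight_matrix n w)),
     solutions = (\<lambda>(n, w). ham_cycles (complete_on n)),
     objective = (\<lambda>(n, w) H. \<Sum>e\<in>H. w e),
     sol_words = edge_words\<rparr>"

definition DiffRTSP ::
  "variant \<Rightarrow> norm_kind \<Rightarrow> (nat \<times> (nat \<times> nat \<Rightarrow> real) \<times> real, (nat \<times> nat) set) min_problem" where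
  "DiffRTSP a p = \<lparr>instances = {(n, w, \<epsilon>). 2 \<le> n \<and> weights_ok n w \<and> 0 \<le> \<epsilon>},
     encode = (\<lambda>(n, w, \<epsilon>). ([n], weight_matrix n w @ [\<epsilon>])),
     solutions = (\<lambda>(n, w, \<epsilon>). ham_cycles (complete_on n)),
     objective = (\<lambda>(n, w, \<epsilon>). worst_cost w (uncertainty_set a p (complete_on n) w \<epsilon>)),
     sol_words = edge_words\<rparr>"

lemma optimum_TSP: "optimum TSP (n, w) = tsp_opt (complete_on n) w"
  by (simp add: optimum_def TSP_def tsp_opt_def)

lemma optimum_DiffRTSP:
  "optimum (DiffRTSP a p) (n, w, \<epsilon>) =
     rtsp_opt (complete_on n) w (uncertainty_set a p (complete_on n) w \<epsilon>)"
  by (simp add: optimum_def DiffRTSP_def rtsp_opt_def)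

end

theory Submission
  imports Defs
begin

text \<open>
  A Hamiltonian cycle \<open>H\<close> has exactly one edge entering and exactly one edge leaving each vertex. By
  conservation, the weight that the adversary removes from the edges entering \<open>u\<close> is the weight it adds
  to the edges leaving \<open>u\<close>. Removing weight from the edge of \<open>H\<close> that enters \<open>u\<close> gains nothing, as at
  most the removed amount comes back on the edge of \<open>H\<close> that leaves \<open>u\<close>. So the best the adversary can
  do is to remove weight from edges outside \<open>H\<close> and to put all of it, at every vertex, on the edge of
  \<open>H\<close> that leaves this vertex. This determines the worst case for a fixed cycle.

  For the norm \<open>\<infinity>\<close> the vertices do not interact. The gain at \<open>u\<close> is the minimum of \<open>\<epsilon>\<close> and the weight
  entering \<open>u\<close> outside \<open>H\<close>, so \<open>H\<close> costs \<open>\<Sum>e\<in>H. min (w e + \<epsilon>) (inflow G w (head G e))\<close>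
  (\<open>worst_cost_S_Norm_Inf\<close>). This is the ordinary cost of \<open>H\<close> for modified weights that do not depend
  on \<open>H\<close>.

  For the norm 1, the total decrease equals the total increase, so each is at most \<open>\<epsilon> / 2\<close>, and \<open>H\<close>
  costs \<open>min (w(H) + \<epsilon> / 2) (w(E))\<close> (\<open>worst_cost_Norm_1\<close>). This is a nondecreasing function of \<open>w(H)\<close>, so
  every optimal solution of ordinary TSP is optimal, and the optimal values are related by the same
  function. The large set has the same worst case as the small one: decreasing an edge outside \<open>H\<close> by
  more than its weight requires an equal increase of that edge, which is lost for \<open>H\<close>.

  For \<open>\<epsilon> = 0\<close> both formulas give \<open>w(H)\<close>, which is the reduction from ordinary TSP.

  What remains is to perform these transformations by programs in polynomial time. Every program
  makes at most two passes over its input, so it evaluates linearly many expressions. Every real number it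
  computes is a sum of numbers at distinct positions of the input, one of them possibly halved, and so is
  of a size linear in the input size. The locale \<open>size_measure\<close> states the properties of the size of numbers used for this; they
  hold for unit costs and for binary lengths of rationals, so that one analysis serves both cost
  models.
\<close>

section \<open>Hamiltonian cycles\<close>

text \<open>The vertices after the start of a closed walk are the heads of its edges, and a cycle repeats none of
  them; so heads are distinct. They are as many as the edges, and the tails cover the same
  set, so tails are distinct too.\<close>

lemma (in wf_digraph) ham_cycle_bij_betw:
  assumes "H \<in> ham_cycles G"
  shows "H \<subseteq> arcs G" "bij_betw (tail G) H (verts G)" "bij_betw (head G) H (verts G)"
proof -
  obtain p u where H: "H = set p" and walk: "awalk u p u" and dist: "distinct (tl (awalk_verts u p))"
    and "p \<noteq> []" and cover: "tail G ` set p = verts G"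
    using assms by (auto simp: ham_cycles_def cycle_def)
  have cas: "cas u p u" and sub: "set p \<subseteq> arcs G" using walk by (auto simp: awalk_def)
  have verts1: "awalk_verts u p = tail G (hd p) # map (head G) p"
    using awalk_verts_conv'[OF cas] \<open>p \<noteq> []\<close> by simp
  have "tail G (hd p) = u" "head G (last p) = u"
    using awhd_if_cas[OF cas] awlast_if_cas[OF cas] \<open>p \<noteq> []\<close>
    by (simp_all add: awalk_verts_conv hd_append hd_map last_map)
  then have "set (map (head G) p) = set (awalk_verts u p)"
    using verts1 imageI[OF last_in_set[OF \<open>p \<noteq> []\<close>], of "head G"] by auto
  also have "\<dots> = set (map (tail G) p)"
    using \<open>tail G (hd p) = u\<close> \<open>head G (last p) = u\<close> \<open>p \<noteq> []\<close> hd_in_set[OF \<open>p \<noteq> []\<close>]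
    by (force simp: awalk_verts_conv)
  finally have heads: "head G ` set p = verts G" using cover by simp
  have "inj_on (head G) (set p)" using dist verts1 by (simp add: distinct_map)
  then have "card (tail G ` set p) = card (set p)" using heads cover by (metis card_image)
  then have "inj_on (tail G) (set p)" by (simp add: eq_card_imp_inj_on)
  then show "H \<subseteq> arcs G" "bij_betw (tail G) H (verts G)" "bij_betw (head G) H (verts G)"
    using sub heads cover \<open>inj_on (head G) (set p)\<close> H by (auto simp: bij_betw_def)
qed

lemma (in fin_digraph) finite_ham_cycles: "finite (ham_cycles G)"
  by (rule finite_subset[of _ "Pow (arcs G)"]) (auto dest: ham_cycle_bij_betw(1))

lemma fin_digraph_complete_on: "fin_digraph (complete_on n)"
  using complete_digraph_complete_on[of n] graph.axioms(1) digraph.axioms(1)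
  unfolding complete_digraph_def by blast

text \<open>The cycle \<open>0, 1, \<dots>, n - 1, 0\<close>. Hence the optimal value of an instance is attained, which the
  transfer of optimal values through a monotone function requires.\<close>

lemma ham_cycles_complete_on_nonempty:
  assumes "2 \<le> n"
  shows "ham_cycles (complete_on n) \<noteq> {}"
proof -
  let ?G = "complete_on n"
  interpret fin_digraph ?G by (rule fin_digraph_complete_on)
  have sel: "verts ?G = {..<n}" "arcs ?G = {(u, v). u < n \<and> v < n \<and> u \<noteq> v}" "tail ?G = fst" "head ?G = snd"
    by (auto simp: complete_on_def)
  let ?q = "\<lambda>k. map (\<lambda>i. (i, Suc i)) [0..<k]"
  have path: "awalk 0 (?q k) k \<and> awlast 0 (?q k) = k" if "k < n" for k
    using that
  proof (induction k)
    case 0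
    then show ?case by (simp add: awalk_Nil_iff sel)
  next
    case (Suc k)
    then show ?case by (simp add: awalk_simps sel awlast_append)
  qed
  obtain m where n: "n = Suc m" "m < n" "m \<noteq> 0" using assms by (cases n) auto
  let ?p = "?q m @ [(m, 0)]"
  have "awalk 0 ?p 0" using path[OF n(2)] n(2,3) by (simp add: awalk_simps sel)
  moreover have "tl (awalk_verts 0 ?p) = map snd ?p"
    using awalk_verts_conv'[of 0 ?p 0] \<open>awalk 0 ?p 0\<close> by (auto simp: awalk_def sel)
  then have "distinct (tl (awalk_verts 0 ?p))" by (simp add: comp_def distinct_map)
  ultimately have "cycle ?p" by (auto simp: cycle_def)
  moreover have "tail ?G ` set ?p = verts ?G" unfolding sel using n(1,3) by (auto simp: image_iff Bex_def less_Suc_eq)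
  ultimately show ?thesis unfolding ham_cycles_def by blast
qed

section \<open>The worst case for a fixed Hamiltonian cycle\<close>

lemma (in wf_digraph) partition_arcs:
  "(\<Union>u\<in>verts G. in_arcs G u) = arcs G" "(\<Union>u\<in>verts G. out_arcs G u) = arcs G"
  by auto

lemma (in fin_digraph) sum_arcs_by_head: "(\<Sum>u\<in>verts G. \<Sum>e\<in>in_arcs G u. f e) = sum f (arcs G)"
  by (subst sum.UNION_disjoint[symmetric]) (auto simp: partition_arcs)

lemma (in fin_digraph) sum_arcs_by_tail: "(\<Sum>u\<in>verts G. \<Sum>e\<in>out_arcs G u. f e) = sum f (arcs G)"
  by (subst sum.UNION_disjoint[symmetric]) (auto simp: partition_arcs)

lemma worst_cost_eqI:
  assumes "(dp, dm) \<in> D" "(\<Sum>e\<in>H. w e + dp e - dm e) = c"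
    and "\<And>dp dm. (dp, dm) \<in> D \<Longrightarrow> (\<Sum>e\<in>H. w e + dp e - dm e) \<le> c"
  shows "worst_cost w D H = c"
  unfolding worst_cost_def using assms by (intro Greatest_equality) auto

text \<open>For the 1-norm this makes the bound \<open>\<epsilon>\<close> on the norm a bound \<open>\<epsilon> / 2\<close> on each of the two parts.\<close>

lemma (in fin_digraph) conservation_total:
  fixes dp dm :: "'b \<Rightarrow> real"
  assumes "\<forall>u\<in>verts G. sum dm (in_arcs G u) = sum dp (out_arcs G u)"
  shows "sum dm (arcs G) = sum dp (arcs G)"
  using assms sum_arcs_by_head[of dm] sum_arcs_by_tail[of dp] by simp

definition inflow :: "('v, 'e) pre_digraph \<Rightarrow> ('e \<Rightarrow> real) \<Rightarrow> 'v \<Rightarrow> real" where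
  "inflow G w u = sum w (in_arcs G u)"

locale weighted_ham_cycle = fin_digraph G for G :: "('v, 'e) pre_digraph" +
  fixes w :: "'e \<Rightarrow> real" and H :: "'e set"
  assumes ham: "H \<in> ham_cycles G" and weights_nonneg: "e \<in> arcs G \<Longrightarrow> 0 \<le> w e"
begin

lemmas H_arcs = ham_cycle_bij_betw(1)[OF ham]
  and bij_tail = ham_cycle_bij_betw(2)[OF ham]
  and bij_head = ham_cycle_bij_betw(3)[OF ham]

lemma sum_via_head: "(\<Sum>e\<in>H. f (head G e)) = sum f (verts G)"
  by (rule sum.reindex_bij_betw[OF bij_head])

lemma sum_via_tail: "(\<Sum>e\<in>H. f (tail G e)) = sum f (verts G)"
  by (rule sum.reindex_bij_betw[OF bij_tail])

definition off_inflow :: "'v \<Rightarrow> real" where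
  "off_inflow u = sum w (in_arcs G u - H)"

text \<open>The strategy of the adversary: take the fraction \<open>l u\<close> of the weight of every edge that enters \<open>u\<close>
  outside of \<open>H\<close>, and put what was taken on the edge of \<open>H\<close> that leaves \<open>u\<close>. Both optimal strategies
  have this form, with different fractions.\<close>

definition divert_minus :: "('v \<Rightarrow> real) \<Rightarrow> 'e \<Rightarrow> real" where
  "divert_minus l e = (if e \<in> H then 0 else l (head G e) * w e)"

definition divert_plus :: "('v \<Rightarrow> real) \<Rightarrow> 'e \<Rightarrow> real" where
  "divert_plus l e = (if e \<in> H then l (tail G e) * off_inflow (tail G e) else 0)"

lemma in_arcs_inter_H: "e \<in> H \<Longrightarrow> in_arcs G (head G e) \<inter> H = {e}"
  using H_arcs inj_onD[OF bij_betw_imp_inj_on[OF bij_head]] by force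

lemma out_arcs_inter_H: "e \<in> H \<Longrightarrow> out_arcs G (tail G e) \<inter> H = {e}"
  using H_arcs inj_onD[OF bij_betw_imp_inj_on[OF bij_tail]] by force

lemma inflow_split: "e \<in> H \<Longrightarrow> inflow G w (head G e) = w e + off_inflow (head G e)"
  unfolding inflow_def off_inflow_def
  using sum.Int_Diff[of "in_arcs G (head G e)" w H] in_arcs_inter_H[of e] finite_in_arcs by simp

lemma off_inflow_nonneg: "0 \<le> off_inflow u"
  unfolding off_inflow_def by (rule sum_nonneg) (auto intro: weights_nonneg)

lemma sum_off_inflow: "sum off_inflow (verts G) = sum w (arcs G) - sum w H"
proof -
  have "sum w (arcs G) = (\<Sum>e\<in>H. inflow G w (head G e))"
    unfolding sum_via_head by (simp add: inflow_def sum_arcs_by_head)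
  then show ?thesis by (simp add: inflow_split sum.distrib sum_via_head)
qed

lemma sum_divert_minus: "sum (divert_minus l) (in_arcs G u) = l u * off_inflow u"
proof -
  have "sum (divert_minus l) (in_arcs G u) = sum (divert_minus l) (in_arcs G u - H)"
    by (rule sum.mono_neutral_right) (auto simp: divert_minus_def)
  also have "\<dots> = (\<Sum>e\<in>in_arcs G u - H. l u * w e)"
    by (rule sum.cong) (auto simp: divert_minus_def)
  finally show ?thesis by (simp add: off_inflow_def sum_distrib_left)
qed

lemma sum_divert_plus:
  assumes "u \<in> verts G"
  shows "sum (divert_plus l) (out_arcs G u) = l u * off_inflow u"
proof -
  obtain e where e: "e \<in> H" "tail G e = u" using assms bij_tail by (metis bij_betw_imp_surj_on imageE)
  have "sum (divert_plus l) (out_arcs G u) = sum (divert_plus l) (out_arcs G u \<inter> H)"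
    by (rule sum.mono_neutral_right) (auto simp: divert_plus_def)
  then show ?thesis using out_arcs_inter_H[of e] e by (simp add: divert_plus_def)
qed

lemma divert_conservation:
  "u \<in> verts G \<Longrightarrow> sum (divert_minus l) (in_arcs G u) = sum (divert_plus l) (out_arcs G u)"
  by (simp add: sum_divert_minus sum_divert_plus)

lemma divert_total:
  "sum (divert_minus l) (arcs G) = (\<Sum>u\<in>verts G. l u * off_inflow u)"
  "sum (divert_plus l) (arcs G) = (\<Sum>u\<in>verts G. l u * off_inflow u)"
  by (simp_all add: sum_divert_minus sum_divert_plus
        flip: sum_arcs_by_head[of "divert_minus l"] sum_arcs_by_tail[of "divert_plus l"])

lemma divert_cost:
  "(\<Sum>e\<in>H. w e + divert_plus l e - divert_minus l e) = sum w H + (\<Sum>u\<in>verts G. l u * off_inflow u)"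
  by (simp add: divert_plus_def divert_minus_def sum.distrib
        sum_via_tail[of "\<lambda>u. l u * off_inflow u"])

lemma divert_nonneg:
  assumes "\<And>u. 0 \<le> l u" "e \<in> arcs G"
  shows "0 \<le> divert_minus l e" "0 \<le> divert_plus l e"
  using assms by (auto simp: divert_minus_def divert_plus_def weights_nonneg off_inflow_nonneg)

lemma divert_minus_le:
  assumes "\<And>u. l u \<le> 1" "e \<in> arcs G"
  shows "divert_minus l e \<le> w e"
  using assms mult_right_mono[of "l (head G e)" 1 "w e"] by (auto simp: divert_minus_def weights_nonneg)

text \<open>The fraction taken at \<open>u\<close> is chosen so that the diverted weight is the minimum of \<open>\<epsilon>\<close> and all
  that is available. Conversely, the edge \<open>f\<close> of \<open>H\<close> leaving \<open>u\<close> grows by at most \<open>\<epsilon>\<close>, and by at most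
  the total decrease of the edges entering \<open>u\<close>; in the second bound, the part due to the edge of \<open>H\<close>
  entering \<open>u\<close> cancels against the decrease of this edge itself. Charging the growth of \<open>f\<close> to the edge of \<open>H\<close>
  that enters \<open>u\<close> gives the sum its form.\<close>

lemma worst_cost_S_Norm_Inf:
  assumes "0 \<le> \<epsilon>"
  shows "worst_cost w (uncertainty_set Variant_S Norm_Inf G w \<epsilon>) H
    = (\<Sum>e\<in>H. min (w e + \<epsilon>) (inflow G w (head G e)))"
proof (rule worst_cost_eqI)
  \<comment> \<open>If there is nothing to take, then \<open>l u = 0\<close> because of \<open>x / 0 = 0\<close>.\<close>
  define l where "l = (\<lambda>u. min \<epsilon> (off_inflow u) / off_inflow u)"
  have l: "l u * off_inflow u = min \<epsilon> (off_inflow u)" for u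
    using assms by (auto simp: l_def)
  have l01: "0 \<le> l u" "l u \<le> 1" for u
    using off_inflow_nonneg[of u] assms by (auto simp: l_def divide_le_eq_1)
  have minus_le: "divert_minus l e \<le> \<epsilon>" if "e \<in> arcs G" for e
  proof -
    have "divert_minus l e \<le> sum (divert_minus l) (in_arcs G (head G e))"
      using that by (intro member_le_sum) (auto intro: divert_nonneg l01)
    then show ?thesis by (simp add: sum_divert_minus l)
  qed
  have "divert_plus l e \<le> \<epsilon>" for e using assms by (simp add: divert_plus_def l)
  then show "(divert_plus l, divert_minus l) \<in> uncertainty_set Variant_S Norm_Inf G w \<epsilon>"
    using assms minus_le by (auto simp: uncertainty_set_def divert_nonneg l01 divert_conservation divert_minus_le)
  have "min (w e + \<epsilon>) (inflow G w (head G e)) = w e + min \<epsilon> (off_inflow (head G e))" if "e \<in> H" for e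
    using that by (simp add: inflow_split)
  then show "(\<Sum>e\<in>H. w e + divert_plus l e - divert_minus l e)
      = (\<Sum>e\<in>H. min (w e + \<epsilon>) (inflow G w (head G e)))"
    unfolding divert_cost by (simp add: l sum.distrib sum_via_head[of "\<lambda>u. min \<epsilon> (off_inflow u)"])
next
  fix dp dm assume D: "(dp, dm) \<in> uncertainty_set Variant_S Norm_Inf G w \<epsilon>"
  then have nonneg: "\<And>e. e \<in> arcs G \<Longrightarrow> 0 \<le> dp e \<and> 0 \<le> dm e"
    and cons: "\<And>u. u \<in> verts G \<Longrightarrow> sum dm (in_arcs G u) = sum dp (out_arcs G u)"
    and le: "\<And>e. e \<in> arcs G \<Longrightarrow> dm e \<le> w e"
    and eps: "\<And>e. e \<in> arcs G \<Longrightarrow> dp e \<le> \<epsilon>"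
    by (auto simp: uncertainty_set_def)
  let ?out = "\<lambda>u. sum dp (out_arcs G u \<inter> H)"
  \<comment> \<open>Rearrange the increases on \<open>H\<close>: instead of the edge itself, each edge is assigned its successor in \<open>H\<close>.\<close>
  have "(\<Sum>e\<in>H. dp e) = (\<Sum>e\<in>H. ?out (tail G e))"
    by (rule sum.cong) (auto simp: out_arcs_inter_H)
  also have "\<dots> = (\<Sum>e\<in>H. ?out (head G e))"
    using sum_via_tail[of ?out] sum_via_head[of ?out] by simp
  finally have "(\<Sum>e\<in>H. w e + dp e - dm e) = (\<Sum>e\<in>H. w e + ?out (head G e) - dm e)"
    by (simp add: sum.distrib sum_subtractf)
  also have "\<dots> \<le> (\<Sum>e\<in>H. min (w e + \<epsilon>) (inflow G w (head G e)))"
  proof (rule sum_mono)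
    fix e assume e: "e \<in> H"
    then have u: "head G e \<in> verts G" using H_arcs by auto
    then obtain f where f: "f \<in> H" "tail G f = head G e" using bij_tail by (metis bij_betw_imp_surj_on imageE)
    then have out: "?out (head G e) = dp f" using out_arcs_inter_H[of f] by simp
    have "dp f \<le> sum dp (out_arcs G (head G e))"
      using f H_arcs by (intro member_le_sum) (auto simp: nonneg)
    also have "\<dots> = sum dm (in_arcs G (head G e))" using cons u by simp
    also have "\<dots> = dm e + sum dm (in_arcs G (head G e) - H)"
      using sum.Int_Diff[of "in_arcs G (head G e)" dm H] in_arcs_inter_H[OF e] finite_in_arcs by simp
    also have "sum dm (in_arcs G (head G e) - H) \<le> off_inflow (head G e)"
      unfolding off_inflow_def by (rule sum_mono) (auto simp: le)
    finally have "dp f - dm e \<le> off_inflow (head G e)" by simp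
    moreover have "dp f \<le> \<epsilon>" "0 \<le> dm e" using eps nonneg f e H_arcs by auto
    ultimately show "w e + ?out (head G e) - dm e \<le> min (w e + \<epsilon>) (inflow G w (head G e))"
      unfolding out using inflow_split[OF e] by auto
  qed
  finally show "(\<Sum>e\<in>H. w e + dp e - dm e) \<le> (\<Sum>e\<in>H. min (w e + \<epsilon>) (inflow G w (head G e)))" .
qed

text \<open>One fraction for all vertices suffices, as only the total counts. For the upper bound, conservation
  allows to express the gain on \<open>H\<close> as the net loss of the edges outside \<open>H\<close>. The net loss of an
  edge is at most its weight under either capacity constraint, and the optimal strategy meets the
  stricter one.\<close>

lemma worst_cost_Norm_1:
  assumes "0 \<le> \<epsilon>"
  shows "worst_cost w (uncertainty_set a Norm_1 G w \<epsilon>) H = min (sum w H + \<epsilon> / 2) (sum w (arcs G))"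
proof (rule worst_cost_eqI)
  define R where "R = sum w (arcs G) - sum w H"
  have R: "sum off_inflow (verts G) = R" by (simp add: R_def sum_off_inflow)
  have "0 \<le> R" unfolding R[symmetric] by (simp add: sum_nonneg off_inflow_nonneg)
  define l where "l = min (\<epsilon> / 2) R / R"
  have l01: "0 \<le> l" "l \<le> 1" using \<open>0 \<le> R\<close> assms by (auto simp: l_def divide_le_eq_1)
  have total: "(\<Sum>u\<in>verts G. l * off_inflow u) = min (\<epsilon> / 2) R"
    unfolding sum_distrib_left[symmetric] R using \<open>0 \<le> R\<close> assms by (auto simp: l_def)
  let ?p = "divert_plus (\<lambda>_. l)" and ?m = "divert_minus (\<lambda>_. l)"
  have nonneg: "e \<in> arcs G \<Longrightarrow> 0 \<le> ?p e \<and> 0 \<le> ?m e" for e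
    using l01 by (simp add: divert_nonneg)
  have "?m e \<le> decrease_cap a w ?p e" if "e \<in> arcs G" for e
    using divert_minus_le[of "\<lambda>_. l" e] nonneg[OF that] that l01 by (cases a) auto
  moreover have "pair_norm Norm_1 (arcs G) (?p, ?m) \<le> \<epsilon>"
    using nonneg by (simp add: divert_total total)
  ultimately show "(?p, ?m) \<in> uncertainty_set a Norm_1 G w \<epsilon>"
    using nonneg by (auto simp: uncertainty_set_def divert_conservation)
  show "(\<Sum>e\<in>H. w e + ?p e - ?m e) = min (sum w H + \<epsilon> / 2) (sum w (arcs G))"
    unfolding divert_cost total R_def by auto
next
  fix dp dm assume D: "(dp, dm) \<in> uncertainty_set a Norm_1 G w \<epsilon>"
  then have nonneg: "\<And>e. e \<in> arcs G \<Longrightarrow> 0 \<le> dp e \<and> 0 \<le> dm e"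
    and cons: "\<forall>u\<in>verts G. sum dm (in_arcs G u) = sum dp (out_arcs G u)"
    and cap: "\<And>e. e \<in> arcs G \<Longrightarrow> dm e \<le> decrease_cap a w dp e"
    and norm: "sum dp (arcs G) + sum dm (arcs G) \<le> \<epsilon>"
    by (auto simp: uncertainty_set_def)
  have le: "dm e \<le> w e + dp e" if "e \<in> arcs G" for e
    using cap[OF that] nonneg[OF that] by (cases a) auto
  note total = conservation_total[OF cons]
  have split: "sum f (arcs G) = sum f H + sum f (arcs G - H)" for f :: "'e \<Rightarrow> real"
    using sum.subset_diff[OF H_arcs finite_arcs, of f] by simp
  have "sum dp H \<le> sum dp (arcs G)" "0 \<le> sum dm H"
    using H_arcs nonneg by (auto intro!: sum_mono2 sum_nonneg)
  then have "sum dp H - sum dm H \<le> \<epsilon> / 2" using total norm by linarith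
  moreover have "sum dm (arcs G - H) \<le> sum w (arcs G - H) + sum dp (arcs G - H)"
    unfolding sum.distrib[symmetric] by (rule sum_mono) (auto simp: le)
  then have "sum w H + sum dp H - sum dm H \<le> sum w (arcs G)"
    using total split[of dp] split[of dm] split[of w] by linarith
  ultimately show "(\<Sum>e\<in>H. w e + dp e - dm e) \<le> min (sum w H + \<epsilon> / 2) (sum w (arcs G))"
    by (simp add: sum.distrib sum_subtractf)
qed

lemma sum_H_le: "sum w H \<le> sum w (arcs G)"
  using H_arcs weights_nonneg by (auto intro!: sum_mono2)

lemma worst_cost_radius_0:
  assumes "(a, p) \<in> {(Variant_S, Norm_Inf), (Variant_S, Norm_1), (Variant_L, Norm_1)}"
  shows "worst_cost w (uncertainty_set a p G w 0) H = sum w H"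
proof -
  have "(\<Sum>e\<in>H. min (w e + 0) (inflow G w (head G e))) = sum w H"
    by (rule sum.cong) (simp_all add: inflow_split off_inflow_nonneg)
  then have "worst_cost w (uncertainty_set Variant_S Norm_Inf G w 0) H = sum w H"
    by (simp add: worst_cost_S_Norm_Inf)
  moreover have "worst_cost w (uncertainty_set a Norm_1 G w 0) H = sum w H"
    using worst_cost_Norm_1[of 0 a] sum_H_le by simp
  ultimately show ?thesis using assms by blast
qed

end


section \<open>The sizes of real numbers\<close>

text \<open>\<open>bounded k r\<close> bounds the size of \<open>r\<close> up to constants, but unlike the size itself, it behaves additively under
  addition of numbers: a direct estimate of \<open>sz (r + s)\<close> by \<open>sz r\<close> and \<open>sz s\<close> loses a constant factor at
  every addition, which is too much for sums of many numbers. The 1 in \<open>bounded_add\<close> is absorbed in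
  \<open>bounded_sum\<close> because an input word contributes \<open>1 + sz r\<close> to the input size for each of its numbers \<open>r\<close>.\<close>

locale size_measure =
  fixes sz :: "real \<Rightarrow> nat" and bounded :: "nat \<Rightarrow> real \<Rightarrow> bool"
  assumes size_le: "bounded k r \<Longrightarrow> sz r \<le> 2 * k + 2"
    and bounded_mono: "bounded k r \<Longrightarrow> k \<le> l \<Longrightarrow> bounded l r"
    and bounded_0: "bounded 0 0"
    and bounded_2: "bounded 1 2"
    and bounded_add: "bounded k r \<Longrightarrow> bounded l s \<Longrightarrow> bounded (k + l + 1) (r + s)"
    and bounded_half: "bounded k r \<Longrightarrow> bounded (k + 1) (r / 2)"
begin

lemma bounded_sum:
  assumes "finite A" "\<And>i. i \<in> A \<Longrightarrow> bounded (sz (f i)) (f i)"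
  shows "bounded (\<Sum>i\<in>A. 1 + sz (f i)) (sum f A)"
  using assms
proof (induction A)
  case empty
  then show ?case by (simp add: bounded_0)
next
  case (insert i A)
  then show ?case
    using bounded_add[of "sz (f i)" "f i" "\<Sum>i\<in>A. 1 + sz (f i)" "sum f A"] by (simp add: ac_simps)
qed

end

lemma size_measure_unit: "size_measure unit_size (\<lambda>_ _. True)"
  by unfold_locales (auto simp: unit_size_def)

text \<open>The fraction need not be reduced: this is what makes the bound compatible with addition over the
  product of the denominators.\<close>

definition height_le :: "nat \<Rightarrow> real \<Rightarrow> bool" where
  "height_le k r \<longleftrightarrow> (\<exists>a b :: int. 0 < b \<and> r = of_int a / of_int b \<and> \<bar>a\<bar> \<le> 2 ^ k \<and> b \<le> 2 ^ k)"

lemma nat_size_le_iff: "nat_size n \<le> k \<longleftrightarrow> n < 2 ^ k"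
  by (simp add: nat_size_def floorlog_le_iff)

lemma bit_size_of_rat:
  "bit_size (of_rat x) = nat_size (nat \<bar>fst (quotient_of x)\<bar>) + nat_size (nat (snd (quotient_of x)))"
  by (simp add: bit_size_def the_inv_f_f inj_on_def case_prod_beta)

lemma height_le_bit_size:
  assumes "r \<in> \<rat>"
  shows "height_le (bit_size r) r"
proof -
  obtain x where x: "r = of_rat x" using assms by (auto simp: Rats_def)
  obtain a b where ab: "quotient_of x = (a, b)" by fastforce
  then have "0 < b" "r = of_int a / of_int b"
    using quotient_of_denom_pos quotient_of_div[OF ab] x by (auto simp: of_rat_divide)
  moreover have size: "bit_size r = nat_size (nat \<bar>a\<bar>) + nat_size (nat b)"
    using bit_size_of_rat[of x] ab x by simp
  have "nat \<bar>a\<bar> < 2 ^ bit_size r" "nat b < 2 ^ bit_size r"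
    unfolding nat_size_le_iff[symmetric] size by auto
  then have "\<bar>a\<bar> \<le> 2 ^ bit_size r" "b \<le> 2 ^ bit_size r"
    by (simp_all add: nat_less_iff zless_nat_eq_int_zless)
  ultimately show ?thesis unfolding height_le_def by blast
qed

lemma bit_size_le:
  assumes "height_le k r"
  shows "bit_size r \<le> 2 * k + 2"
proof -
  obtain a b :: int where ab: "0 < b" "r = of_int a / of_int b" "\<bar>a\<bar> \<le> 2 ^ k" "b \<le> 2 ^ k"
    using assms unfolding height_le_def by blast
  have r: "r = of_rat (Fract a b)" using ab by (simp add: of_rat_rat)
  define g where "g = gcd a b"
  have "0 < g" using ab by (simp add: g_def)
  obtain a' b' where a': "a = g * a'" and b': "b = g * b'"
    unfolding g_def by (metis dvd_def gcd_dvd1 gcd_dvd2)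
  have "a div g = a'" "b div g = b'" using \<open>0 < g\<close> a' b' by simp_all
  then have q: "quotient_of (Fract a b) = (a', b')"
    using \<open>0 < b\<close> by (simp add: quotient_of_Fract Rat.normalize_def Let_def flip: g_def)
  have "\<bar>a'\<bar> \<le> \<bar>a\<bar>" "0 < b'" "b' \<le> b"
    using \<open>0 < g\<close> \<open>0 < b\<close> unfolding a' b' by (auto simp: abs_mult zero_less_mult_iff mult_le_cancel_right1)
  then have "nat \<bar>a'\<bar> < 2 ^ Suc k" "nat b' < 2 ^ Suc k"
    using ab(3,4) by (auto simp: nat_less_iff)
  then have "nat_size (nat \<bar>a'\<bar>) \<le> Suc k" "nat_size (nat b') \<le> Suc k"
    by (simp_all only: nat_size_le_iff)
  then show ?thesis unfolding r bit_size_of_rat q by simp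
qed

lemma size_measure_bit: "size_measure bit_size height_le"
proof
  fix k r assume "height_le k r"
  then show "bit_size r \<le> 2 * k + 2" by (rule bit_size_le)
  fix l :: nat assume "k \<le> l"
  then have "(2 :: int) ^ k \<le> 2 ^ l" by simp
  then show "height_le l r" using \<open>height_le k r\<close> unfolding height_le_def by (blast intro: order_trans)
next
  show "height_le 0 0" unfolding height_le_def by (rule exI[of _ 0], rule exI[of _ 1]) simp
  show "height_le 1 2" unfolding height_le_def by (rule exI[of _ 2], rule exI[of _ 1]) simp
next
  fix k l r s assume "height_le k r" "height_le l s"
  then obtain a b c d :: int where ab: "0 < b" "r = of_int a / of_int b" "\<bar>a\<bar> \<le> 2 ^ k" "b \<le> 2 ^ k"
    and cd: "0 < d" "s = of_int c / of_int d" "\<bar>c\<bar> \<le> 2 ^ l" "d \<le> 2 ^ l"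
    unfolding height_le_def by blast
  have "\<bar>a * d + c * b\<bar> \<le> \<bar>a\<bar> * d + \<bar>c\<bar> * b"
    using abs_triangle_ineq[of "a * d" "c * b"] ab cd by (simp add: abs_mult)
  also have "\<dots> \<le> 2 ^ k * 2 ^ l + 2 ^ l * 2 ^ k"
    using ab cd by (intro add_mono mult_mono) auto
  finally have "\<bar>a * d + c * b\<bar> \<le> 2 ^ (k + l + 1)" by (simp add: power_add)
  moreover have "b * d \<le> 2 ^ k * 2 ^ l" using ab cd by (intro mult_mono) auto
  then have "b * d \<le> 2 ^ (k + l)" by (simp add: power_add)
  then have "b * d \<le> 2 ^ (k + l + 1)" by (rule order_trans) (rule power_increasing, simp_all)
  moreover have "r + s = of_int (a * d + c * b) / of_int (b * d)" "0 < b * d"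
    using ab cd by (simp_all add: field_simps)
  ultimately show "height_le (k + l + 1) (r + s)" unfolding height_le_def by blast
next
  fix k r assume "height_le k r"
  then obtain a b :: int where ab: "0 < b" "r = of_int a / of_int b" "\<bar>a\<bar> \<le> 2 ^ k" "b \<le> 2 ^ k"
    unfolding height_le_def by blast
  then have "0 < 2 * b" "r / 2 = of_int a / of_int (2 * b)" "\<bar>a\<bar> \<le> 2 ^ (k + 1)" "2 * b \<le> 2 ^ (k + 1)"
    by auto
  then show "height_le (k + 1) (r / 2)" unfolding height_le_def by blast
qed

section \<open>Symbolic execution with running times\<close>

text \<open>Running times are counted in evaluated nodes. The predicates \<open>ifits V\<close>, \<open>rfits sz V\<close>, \<open>tfits sz V\<close>
  and \<open>fits sz V\<close> say that no value that occurs in an evaluation has a size above \<open>V\<close>; then every node costs at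
  most \<open>V + 1\<close>, and the number of nodes is known from the program text alone. For loop-free programs,
  all of this is computed by the simplifier.\<close>

primrec ifits :: "nat \<Rightarrow> iexp \<Rightarrow> state \<Rightarrow> bool" where
  "ifits V (IConst n) s \<longleftrightarrow> nat_size n \<le> V"
| "ifits V (IArr a i) s \<longleftrightarrow> nat_size (ival (IArr a i) s) \<le> V \<and> ifits V i s"
| "ifits V (IAdd e f) s \<longleftrightarrow> nat_size (ival (IAdd e f) s) \<le> V \<and> ifits V e s \<and> ifits V f s"
| "ifits V (ISub e f) s \<longleftrightarrow> nat_size (ival (ISub e f) s) \<le> V \<and> ifits V e s \<and> ifits V f s"
| "ifits V (IMul e f) s \<longleftrightarrow> nat_size (ival (IMul e f) s) \<le> V \<and> ifits V e s \<and> ifits V f s"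

primrec inodes :: "iexp \<Rightarrow> nat" where
  "inodes (IConst n) = 1"
| "inodes (IArr a i) = 1 + inodes i"
| "inodes (IAdd e f) = 1 + inodes e + inodes f"
| "inodes (ISub e f) = 1 + inodes e + inodes f"
| "inodes (IMul e f) = 1 + inodes e + inodes f"

primrec rfits :: "(real \<Rightarrow> nat) \<Rightarrow> nat \<Rightarrow> rexp \<Rightarrow> state \<Rightarrow> bool" where
  "rfits sz V (RConst q) s \<longleftrightarrow> sz (of_rat q) \<le> V"
| "rfits sz V (RArr a i) s \<longleftrightarrow> sz (rval (RArr a i) s) \<le> V \<and> ifits V i s"
| "rfits sz V (RAdd e f) s \<longleftrightarrow> sz (rval (RAdd e f) s) \<le> V \<and> rfits sz V e s \<and> rfits sz V f s"
| "rfits sz V (RSub e f) s \<longleftrightarrow> sz (rval (RSub e f) s) \<le> V \<and> rfits sz V e s \<and> rfits sz V f s"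
| "rfits sz V (RMul e f) s \<longleftrightarrow> sz (rval (RMul e f) s) \<le> V \<and> rfits sz V e s \<and> rfits sz V f s"
| "rfits sz V (RDiv e f) s \<longleftrightarrow> sz (rval (RDiv e f) s) \<le> V \<and> rfits sz V e s \<and> rfits sz V f s"

primrec rnodes :: "rexp \<Rightarrow> nat" where
  "rnodes (RConst q) = 1"
| "rnodes (RArr a i) = 1 + inodes i"
| "rnodes (RAdd e f) = 1 + rnodes e + rnodes f"
| "rnodes (RSub e f) = 1 + rnodes e + rnodes f"
| "rnodes (RMul e f) = 1 + rnodes e + rnodes f"
| "rnodes (RDiv e f) = 1 + rnodes e + rnodes f"

primrec tfits :: "(real \<Rightarrow> nat) \<Rightarrow> nat \<Rightarrow> test \<Rightarrow> state \<Rightarrow> bool" where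
  "tfits sz V (ILess e f) s \<longleftrightarrow> ifits V e s \<and> ifits V f s"
| "tfits sz V (RLess e f) s \<longleftrightarrow> rfits sz V e s \<and> rfits sz V f s"

primrec tnodes :: "test \<Rightarrow> nat" where
  "tnodes (ILess e f) = 1 + inodes e + inodes f"
| "tnodes (RLess e f) = 1 + rnodes e + rnodes f"

text \<open>The final state of a loop-free program. The value for loops is arbitrary: \<open>fits\<close> excludes them.\<close>

primrec run :: "com \<Rightarrow> state \<Rightarrow> state" where
  "run Skip s = s"
| "run (IAssign a i e) s = iupd a (ival i s) (ival e s) s"
| "run (RAssign a i e) s = rupd a (ival i s) (rval e s) s"
| "run (Seq c d) s = run d (run c s)"
| "run (If b c d) s = (if tval b s then run c s else run d s)"
| "run (While b c) s = s"

primrec fits :: "(real \<Rightarrow> nat) \<Rightarrow> nat \<Rightarrow> com \<Rightarrow> state \<Rightarrow> bool" where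
  "fits sz V Skip s \<longleftrightarrow> True"
| "fits sz V (IAssign a i e) s \<longleftrightarrow> ifits V i s \<and> ifits V e s"
| "fits sz V (RAssign a i e) s \<longleftrightarrow> ifits V i s \<and> rfits sz V e s"
| "fits sz V (Seq c d) s \<longleftrightarrow> fits sz V c s \<and> fits sz V d (run c s)"
| "fits sz V (If b c d) s \<longleftrightarrow> tfits sz V b s \<and> (if tval b s then fits sz V c s else fits sz V d s)"
| "fits sz V (While b c) s \<longleftrightarrow> False"

text \<open>Both branches of a conditional are counted, which is an upper bound that does not depend on the state.\<close>

primrec nodes :: "com \<Rightarrow> nat" where
  "nodes Skip = 1"
| "nodes (IAssign a i e) = 1 + inodes i + inodes e"
| "nodes (RAssign a i e) = 1 + inodes i + rnodes e"
| "nodes (Seq c d) = nodes c + nodes d"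
| "nodes (If b c d) = tnodes b + nodes c + nodes d"
| "nodes (While b c) = 0"

lemma icost_le: "ifits V e s \<Longrightarrow> icost e s \<le> inodes e * (V + 1)"
  by (induction e) (auto simp: algebra_simps)

lemma rcost_le: "rfits sz V e s \<Longrightarrow> rcost sz e s \<le> rnodes e * (V + 1)"
  by (induction e) (auto simp: algebra_simps dest: icost_le)

lemma tcost_le: "tfits sz V b s \<Longrightarrow> tcost sz b s \<le> tnodes b * (V + 1)"
  by (cases b) (auto simp: algebra_simps dest!: icost_le rcost_le)

definition steps :: "(real \<Rightarrow> nat) \<Rightarrow> nat \<Rightarrow> com \<Rightarrow> state \<Rightarrow> nat \<Rightarrow> state \<Rightarrow> bool" where
  "steps sz V c s m t \<longleftrightarrow> (\<exists>k. exec sz c s k t \<and> k \<le> m * (V + 1))"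

lemma steps_Seq: "steps sz V c s m t \<Longrightarrow> steps sz V d t l u \<Longrightarrow> steps sz V (Seq c d) s (m + l) u"
  unfolding steps_def by (metis add_mono_thms_linordered_semiring(1) add_mult_distrib exec.Seq)

lemma steps_run: "fits sz V c s \<Longrightarrow> steps sz V c s (nodes c) (run c s)"
proof (induction c arbitrary: s)
  case Skip
  then show ?case by (auto simp: steps_def intro: exec.Skip)
next
  case (IAssign a i e)
  then have "1 + icost i s + icost e s \<le> nodes (IAssign a i e) * (V + 1)"
    using icost_le[of V i s] icost_le[of V e s] by (simp add: algebra_simps)
  then show ?case unfolding steps_def by (metis exec.IAssign run.simps(2))
next
  case (RAssign a i e)
  then have "1 + icost i s + rcost sz e s \<le> nodes (RAssign a i e) * (V + 1)"
    using icost_le[of V i s] rcost_le[of sz V e s] by (simp add: algebra_simps)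
  then show ?case unfolding steps_def by (metis exec.RAssign run.simps(3))
next
  case (Seq c d)
  then show ?case using steps_Seq[OF Seq.IH(1)[of s] Seq.IH(2)[of "run c s"]] by simp
next
  case (If b c d)
  have t: "tcost sz b s \<le> tnodes b * (V + 1)" using If.prems tcost_le[of sz V b s] by simp
  show ?case
  proof (cases "tval b s")
    case True
    then have "steps sz V c s (nodes c) (run c s)" using If.IH(1)[of s] If.prems by simp
    then obtain k where "exec sz c s k (run c s)" "k \<le> nodes c * (V + 1)"
      unfolding steps_def by blast
    moreover from this have "exec sz (If b c d) s (tcost sz b s + k) (run (If b c d) s)"
      using True by (simp add: exec.IfTrue)
    moreover have "tcost sz b s + k \<le> nodes (If b c d) * (V + 1)"
      using calculation(2) t by (simp add: algebra_simps)
    ultimately show ?thesis unfolding steps_def by blast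
  next
    case False
    then have "steps sz V d s (nodes d) (run d s)" using If.IH(2)[of s] If.prems by simp
    then obtain k where "exec sz d s k (run d s)" "k \<le> nodes d * (V + 1)"
      unfolding steps_def by blast
    moreover from this have "exec sz (If b c d) s (tcost sz b s + k) (run (If b c d) s)"
      using False by (simp add: exec.IfFalse)
    moreover have "tcost sz b s + k \<le> nodes (If b c d) * (V + 1)"
      using calculation(2) t by (simp add: algebra_simps)
    ultimately show ?thesis unfolding steps_def by blast
  qed
qed simp

text \<open>A loop is described by the sequence of states at the evaluations of its guard.\<close>

lemma steps_While:
  assumes "\<And>k. k < m \<Longrightarrow> tval b (st k) \<and> tfits sz V b (st k) \<and> fits sz V c (st k) \<and> run c (st k) = st (Suc k)"
    and "\<not> tval b (st m)" "tfits sz V b (st m)"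
  shows "steps sz V (While b c) (st 0) (tnodes b + m * (tnodes b + nodes c)) (st m)"
  using assms
proof (induction m arbitrary: st)
  case 0
  have "tcost sz b (st 0) \<le> (tnodes b + 0 * (tnodes b + nodes c)) * (V + 1)"
    using tcost_le[OF "0.prems"(3)] by simp
  then show ?case unfolding steps_def using exec.WhileFalse[OF "0.prems"(2)] by blast
next
  case (Suc m)
  have "steps sz V (While b c) (st 1) (tnodes b + m * (tnodes b + nodes c)) (st (Suc m))"
    using Suc.IH[of "\<lambda>k. st (Suc k)"] Suc.prems by simp
  then obtain l where l: "exec sz (While b c) (st 1) l (st (Suc m))"
    "l \<le> (tnodes b + m * (tnodes b + nodes c)) * (V + 1)" by (auto simp: steps_def)
  have first: "tval b (st 0)" "tfits sz V b (st 0)" "fits sz V c (st 0)" "run c (st 0) = st 1"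
    using Suc.prems(1)[of 0] by auto
  obtain k where k: "exec sz c (st 0) k (st 1)" "k \<le> nodes c * (V + 1)"
    using steps_run[OF first(3)] first(4) by (auto simp: steps_def)
  have "tcost sz b (st 0) + k + l \<le> (tnodes b + Suc m * (tnodes b + nodes c)) * (V + 1)"
    using tcost_le[OF first(2)] k(2) l(2) by (simp add: algebra_simps)
  then show ?case unfolding steps_def using exec.WhileTrue[OF first(1) k(1) l(1)] by blast
qed

text \<open>A run with linearly many node evaluations on values of linear size, whose output is of linear length
  with entries of linear size. This holds for all programs below and leads to a quadratic time
  bound. The bound \<open>2 * N + 2\<close> is that of \<open>size_le\<close> for numbers bounded by the input size.\<close>

definition transforms :: "nat \<Rightarrow> (real \<Rightarrow> nat) \<Rightarrow> com \<Rightarrow> data \<Rightarrow> data \<Rightarrow> bool" where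
  "transforms C sz c x y \<longleftrightarrow> (let N = data_size sz x in
     (\<exists>m t. steps sz (2 * N + 2) c (load x) m t \<and> m \<le> C * (N + 1) \<and> unload t = y) \<and>
     length (fst y) \<le> N \<and> length (snd y) \<le> N \<and>
     (\<forall>a\<in>set (fst y). nat_size a \<le> 2 * N + 2) \<and> (\<forall>r\<in>set (snd y). sz r \<le> 2 * N + 2))"

lemma sum_list_le_length_times:
  fixes f :: "'a \<Rightarrow> nat"
  shows "(\<forall>x\<in>set xs. f x \<le> b) \<Longrightarrow> (\<Sum>x\<leftarrow>xs. f x) \<le> length xs * b"
  by (induction xs) auto

lemma transforms_computes_within:
  assumes "transforms C sz c x y"
  shows "computes_within sz c x y (poly ([:C + 2, C + 2:] * [:3, 2:]) (data_size sz x))"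
proof -
  define N where "N = data_size sz x"
  obtain k m t where k: "exec sz c (load x) k t" "k \<le> m * (2 * N + 3)" "m \<le> C * (N + 1)" "unload t = y"
    using assms unfolding transforms_def steps_def Let_def N_def by (auto simp: algebra_simps)
  have len: "length (fst y) \<le> N + 1" "length (snd y) \<le> N + 1"
    and small: "\<forall>a\<in>set (fst y). 1 + nat_size a \<le> 2 * N + 3" "\<forall>r\<in>set (snd y). 1 + sz r \<le> 2 * N + 3"
    using assms unfolding transforms_def Let_def N_def by auto
  have "k \<le> C * (N + 1) * (2 * N + 3)"
    using k(2) mult_le_mono1[OF k(3)] by (meson order_trans)
  moreover have "(\<Sum>a\<leftarrow>fst y. 1 + nat_size a) \<le> (N + 1) * (2 * N + 3)"
    using sum_list_le_length_times[OF small(1)] mult_le_mono1[OF len(1)] by (meson order_trans)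
  moreover have "(\<Sum>r\<leftarrow>snd y. 1 + sz r) \<le> (N + 1) * (2 * N + 3)"
    using sum_list_le_length_times[OF small(2)] mult_le_mono1[OF len(2)] by (meson order_trans)
  ultimately have "k + data_size sz y \<le> C * (N + 1) * (2 * N + 3) + 2 * ((N + 1) * (2 * N + 3))"
    unfolding data_size_def by linarith
  also have "\<dots> = poly ([:C + 2, C + 2:] * [:3, 2:]) N"
    by (simp add: algebra_simps)
  finally show ?thesis unfolding computes_within_def N_def[symmetric] using k(1,4) by blast
qed

text \<open>Since the program and the constant are independent of the size measure, an analysis for an arbitrary size measure yields
  both cost models with the same program and the same polynomial.\<close>

lemma poly_timeI:
  assumes "\<And>sz bounded x. size_measure sz bounded \<Longrightarrow> x \<in> X \<Longrightarrow>
     (\<forall>r\<in>set (snd (inp x)). bounded (sz r) r) \<Longrightarrow> transforms C sz c (inp x) (out x)"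
  shows "poly_time X inp out"
  unfolding poly_time_def
  by (intro exI[of _ c] exI[of _ "[:C + 2, C + 2:] * [:3, 2:]"] ballI conjI impI
      transforms_computes_within)
    (auto intro: assms[OF size_measure_unit] assms[OF size_measure_bit] height_le_bit_size)

section \<open>The programs\<close>

lemma nat_size_leI: "m \<le> V \<Longrightarrow> nat_size m \<le> V"
  unfolding nat_size_le_iff by (rule le_less_trans[OF _ less_exp])

lemma member_le_sum_list_nat:
  fixes f :: "'a \<Rightarrow> nat"
  shows "x \<in> set xs \<Longrightarrow> f x \<le> (\<Sum>x\<leftarrow>xs. f x)"
  by (induction xs) auto

lemma length_le_sum_list: "length xs \<le> (\<Sum>x\<leftarrow>xs. 1 + f x :: nat)"
  by (induction xs) auto

lemma data_size_length: "length xs + length rs \<le> data_size sz (xs, rs)"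
  using length_le_sum_list[of xs nat_size] length_le_sum_list[of rs sz] by (simp add: data_size_def)

lemma data_size_nat: "a \<in> set xs \<Longrightarrow> nat_size a \<le> data_size sz (xs, rs)"
  using member_le_sum_list_nat[of a xs "\<lambda>n. 1 + nat_size n"] by (simp add: data_size_def)

lemma data_size_real: "r \<in> set rs \<Longrightarrow> sz r \<le> data_size sz (xs, rs)"
  using member_le_sum_list_nat[of r rs "\<lambda>n. 1 + sz n"] by (simp add: data_size_def)

text \<open>Partial sums of all weights, partial sums of a column, and weights raised by \<open>\<epsilon>\<close> are of this form, so
  their sizes are linear in the input size.\<close>

lemma (in size_measure) bounded_subsum:
  assumes "\<forall>r\<in>set rs. bounded (sz r) r" "A \<subseteq> {..<length rs}"
  shows "bounded (data_size sz (xs, rs)) (\<Sum>i\<in>A. rs ! i)"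
proof (rule bounded_mono)
  have fin: "finite A" using assms(2) finite_subset by blast
  show "bounded (\<Sum>i\<in>A. 1 + sz (rs ! i)) (\<Sum>i\<in>A. rs ! i)"
    using assms by (intro bounded_sum fin) auto
  have "(\<Sum>i\<in>A. 1 + sz (rs ! i)) \<le> (\<Sum>i<length rs. 1 + sz (rs ! i))"
    using assms(2) by (intro sum_mono2) auto
  also have "\<dots> = (\<Sum>r\<leftarrow>rs. 1 + sz r)"
    by (simp add: sum_list_sum_nth atLeast0LessThan)
  finally show "(\<Sum>i\<in>A. 1 + sz (rs ! i)) \<le> data_size sz (xs, rs)" by (simp add: data_size_def)
qed

text \<open>Integer array 2 holds the loop counters. Real array 1 holds the computed sums.\<close>

abbreviation "num_nats \<equiv> IArr 1 (IConst 0)"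
abbreviation "num_reals \<equiv> IArr 1 (IConst 1)"
abbreviation "last_pos \<equiv> ISub num_reals (IConst 1)"
abbreviation "counter i \<equiv> IArr 2 (IConst i)"
abbreviation "set_counter i \<equiv> IAssign 2 (IConst i)"

lemmas machine_simps = iupd_def rupd_def load_def nat_size_leI

lemma transformsI:
  assumes "steps sz (2 * data_size sz x + 2) c (load x) m t" "m \<le> C * (data_size sz x + 1)" "unload t = y"
    and "length (fst y) \<le> data_size sz x" "length (snd y) \<le> data_size sz x"
    and "\<And>a. a \<in> set (fst y) \<Longrightarrow> nat_size a \<le> 2 * data_size sz x + 2"
    and "\<And>r. r \<in> set (snd y) \<Longrightarrow> sz r \<le> 2 * data_size sz x + 2"
  shows "transforms C sz c x y"
  using assms unfolding transforms_def Let_def by blast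

definition drop_real :: com where
  "drop_real = IAssign 1 (IConst 1) last_pos"

lemma transforms_drop_real: "transforms 20 sz drop_real (xs, rs @ [r]) (xs, rs)"
proof (rule transformsI)
  let ?x = "(xs, rs @ [r])"
  note size = data_size_length[of xs "rs @ [r]" sz]
  show "steps sz (2 * data_size sz ?x + 2) drop_real (load ?x) (nodes drop_real) (run drop_real (load ?x))"
    using size by (intro steps_run) (simp add: drop_real_def machine_simps)
  show "nodes drop_real \<le> 20 * (data_size sz ?x + 1)" by (simp add: drop_real_def)
  show "unload (run drop_real (load ?x)) = (xs, rs)"
    by (auto simp: drop_real_def machine_simps unload_def nth_append intro!: nth_equalityI)
  show "nat_size a \<le> 2 * data_size sz ?x + 2" if "a \<in> set (fst (xs, rs))" for a
    using data_size_nat[of a xs sz "rs @ [r]"] that by simp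
  show "sz s \<le> 2 * data_size sz ?x + 2" if "s \<in> set (snd (xs, rs))" for s
    using data_size_real[of s "rs @ [r]" sz xs] that by simp
qed (use data_size_length[of xs "rs @ [r]" sz] in simp_all)

text \<open>The cell after the last real number of the input contains 0, so it only has to be included.\<close>

definition append_0 :: com where
  "append_0 = IAssign 1 (IConst 1) (IAdd num_reals (IConst 1))"

lemma (in size_measure) transforms_append_0:
  assumes "xs \<noteq> []"
  shows "transforms 20 sz append_0 (xs, rs) (xs, rs @ [0])"
proof (rule transformsI)
  let ?x = "(xs, rs)"
  have size: "Suc (length rs) \<le> data_size sz ?x" "length xs \<le> data_size sz ?x"
    using data_size_length[of xs rs sz] assms by (cases xs; simp)+
  show "steps sz (2 * data_size sz ?x + 2) append_0 (load ?x) (nodes append_0) (run append_0 (load ?x))"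
    using size by (intro steps_run) (simp add: append_0_def machine_simps)
  show "nodes append_0 \<le> 20 * (data_size sz ?x + 1)" by (simp add: append_0_def)
  show "unload (run append_0 (load ?x)) = (xs, rs @ [0])"
    by (auto simp: append_0_def machine_simps unload_def nth_append intro!: nth_equalityI)
  show "nat_size a \<le> 2 * data_size sz ?x + 2" if "a \<in> set (fst (xs, rs @ [0]))" for a
    using data_size_nat[of a xs sz rs] that by simp
  show "sz s \<le> 2 * data_size sz ?x + 2" if "s \<in> set (snd (xs, rs @ [0]))" for s
    using data_size_real[of s rs sz xs] that size_le[OF bounded_0] by auto
qed (use data_size_length[of xs rs sz] assms in \<open>cases xs; simp\<close>)+

definition select_last :: com where
  "select_last = Seq (RAssign 0 (IConst 0) (RArr 0 last_pos))
    (Seq (IAssign 1 (IConst 0) (IConst 0)) (IAssign 1 (IConst 1) (IConst 1)))"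

lemma transforms_select_last: "transforms 20 sz select_last (xs, rs @ [r]) ([], [r])"
proof (rule transformsI)
  let ?x = "(xs, rs @ [r])"
  note size = data_size_length[of xs "rs @ [r]" sz]
  have r: "sz r \<le> data_size sz ?x" by (rule data_size_real) simp
  show "steps sz (2 * data_size sz ?x + 2) select_last (load ?x) (nodes select_last) (run select_last (load ?x))"
    using size r by (intro steps_run) (simp add: select_last_def machine_simps)
  show "nodes select_last \<le> 20 * (data_size sz ?x + 1)" by (simp add: select_last_def)
  show "unload (run select_last (load ?x)) = ([], [r])"
    by (simp add: select_last_def machine_simps unload_def)
  show "sz s \<le> 2 * data_size sz ?x + 2" if "s \<in> set (snd ([], [r]))" for s
    using r that by simp
qed (use data_size_length[of xs "rs @ [r]" sz] in simp_all)

text \<open>Recovering a solution: the input is the number of vertices, followed by the word for the solution and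
  the weights; the word has to be moved to the front.\<close>

definition shift_guard :: test where
  "shift_guard = ILess (counter 0) (ISub num_nats (IConst 1))"

definition shift_body :: com where
  "shift_body = Seq (IAssign 0 (counter 0) (IArr 0 (IAdd (counter 0) (IConst 1))))
    (set_counter 0 (IAdd (counter 0) (IConst 1)))"

definition shift_finish :: com where
  "shift_finish = Seq (IAssign 1 (IConst 0) (ISub num_nats (IConst 1))) (IAssign 1 (IConst 1) (IConst 0))"

definition drop_first_nat :: com where
  "drop_first_nat = Seq (While shift_guard shift_body) shift_finish"

lemmas drop_first_nat_defs = drop_first_nat_def shift_guard_def shift_body_def shift_finish_def

lemma transforms_drop_first_nat: "transforms 40 sz drop_first_nat (n # v, rs) (v, [])"
proof (rule transformsI)
  let ?x = "(n # v, rs)"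
  let ?N = "data_size sz ?x"
  define s where "s = load ?x"
  \<comment> \<open>The state after \<open>k\<close> iterations.\<close>
  define st where "st = (\<lambda>k. (\<lambda>a i. if a = 2 \<and> i = 0 then k else if a = 0 \<and> i < k then v ! i
    else fst s a i, snd s))"
  have size: "Suc (length v) \<le> ?N" using data_size_length[of "n # v" rs sz] by simp
  have elem: "nat_size a \<le> 2 * ?N + 2" if "a \<in> set v" for a
    using data_size_nat[of a "n # v" sz rs] that by simp
  have start: "st 0 = load ?x"
    by (auto simp: st_def s_def load_def fun_eq_iff)
  have "steps sz (2 * ?N + 2) (While shift_guard shift_body) (st 0)
      (tnodes shift_guard + length v * (tnodes shift_guard + nodes shift_body)) (st (length v))"
  proof (rule steps_While)
    fix k assume k: "k < length v"
    have "run shift_body (st k) = st (Suc k)"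
      using k by (auto simp: drop_first_nat_defs st_def s_def machine_simps fun_eq_iff less_Suc_eq)
        (metis nth_Cons_Suc)
    moreover have "fits sz (2 * ?N + 2) shift_body (st k)"
      using k size elem[of "v ! k"] by (simp add: drop_first_nat_defs st_def s_def machine_simps)
    ultimately show "tval shift_guard (st k) \<and> tfits sz (2 * ?N + 2) shift_guard (st k) \<and>
        fits sz (2 * ?N + 2) shift_body (st k) \<and> run shift_body (st k) = st (Suc k)"
      using k size by (simp add: drop_first_nat_defs st_def s_def machine_simps)
  qed (use size in \<open>simp_all add: drop_first_nat_defs st_def s_def machine_simps\<close>)
  moreover have "fits sz (2 * ?N + 2) shift_finish (st (length v))"
    using size by (simp add: drop_first_nat_defs st_def s_def machine_simps)
  ultimately show "steps sz (2 * ?N + 2) drop_first_nat (load ?x)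
      (tnodes shift_guard + length v * (tnodes shift_guard + nodes shift_body) + nodes shift_finish)
      (run shift_finish (st (length v)))"
    unfolding drop_first_nat_def start by (rule steps_Seq[OF _ steps_run])
  show "tnodes shift_guard + length v * (tnodes shift_guard + nodes shift_body) + nodes shift_finish
      \<le> 40 * (?N + 1)"
    using size by (simp add: drop_first_nat_defs)
  show "unload (run shift_finish (st (length v))) = (v, [])"
    by (auto simp: drop_first_nat_defs st_def s_def machine_simps unload_def intro!: nth_equalityI)
  show "nat_size a \<le> 2 * ?N + 2" if "a \<in> set (fst (v, [] :: real list))" for a
    using elem that by simp
qed (use data_size_length[of "n # v" rs sz] in simp_all)

text \<open>Recovering the optimal value for the 1-norm, from the weight matrix followed by \<open>\<epsilon>\<close> and the optimal
  value of ordinary TSP: real array 1 accumulates the sum of all weights in cell 0 and holds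
  the raised optimal value in cell 1.\<close>

definition capped_guard :: test where
  "capped_guard = ILess (counter 0) (ISub num_reals (IConst 2))"

definition capped_body :: com where
  "capped_body = Seq (RAssign 1 (IConst 0) (RAdd (RArr 1 (IConst 0)) (RArr 0 (counter 0))))
    (set_counter 0 (IAdd (counter 0) (IConst 1)))"

abbreviation "half_radius_cost \<equiv> RAdd (RArr 0 last_pos) (RDiv (RArr 0 (ISub num_reals (IConst 2))) (RConst 2))"

definition capped_finish :: com where
  "capped_finish = Seq (RAssign 1 (IConst 1) half_radius_cost)
    (Seq (If (RLess (RArr 1 (IConst 1)) (RArr 1 (IConst 0)))
        (RAssign 0 (IConst 0) (RArr 1 (IConst 1))) (RAssign 0 (IConst 0) (RArr 1 (IConst 0))))
    (Seq (IAssign 1 (IConst 0) (IConst 0)) (IAssign 1 (IConst 1) (IConst 1))))"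

definition capped_value :: com where
  "capped_value = Seq (While capped_guard capped_body) capped_finish"

lemmas capped_value_defs = capped_value_def capped_guard_def capped_body_def capped_finish_def

lemma (in size_measure) transforms_capped_value:
  assumes "\<forall>r\<in>set (rs @ [\<epsilon>, c]). bounded (sz r) r"
  shows "transforms 60 sz capped_value (xs, rs @ [\<epsilon>, c]) ([], [min (c + \<epsilon> / 2) (sum_list rs)])"
proof (rule transformsI)
  let ?x = "(xs, rs @ [\<epsilon>, c])"
  define N where "N = data_size sz ?x"
  define s where "s = load ?x"
  \<comment> \<open>The state after \<open>k\<close> iterations.\<close>
  define st where "st = (\<lambda>k. (\<lambda>a i. if a = 2 \<and> i = 0 then k else fst s a i,
    \<lambda>a i. if a = 1 \<and> i = 0 then \<Sum>j<k. rs ! j else snd s a i))"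
  have size: "length xs + length rs + 2 \<le> N"
    using data_size_length[of xs "rs @ [\<epsilon>, c]" sz] by (simp add: N_def)
  have elem: "sz r \<le> 2 * N + 2" if "r \<in> set (rs @ [\<epsilon>, c])" for r
    using data_size_real[OF that, of sz xs] by (simp add: N_def)
  have sums: "sz (\<Sum>j<k. rs ! j) \<le> 2 * N + 2" if "k \<le> length rs" for k
  proof -
    have "(\<Sum>j<k. rs ! j) = (\<Sum>j\<in>{..<k}. (rs @ [\<epsilon>, c]) ! j)"
      using that by (intro sum.cong) (auto simp: nth_append)
    moreover have "bounded N (\<Sum>j\<in>{..<k}. (rs @ [\<epsilon>, c]) ! j)"
      unfolding N_def using that by (intro bounded_subsum assms) auto
    ultimately show ?thesis using size_le by metis
  qed
  have "sz \<epsilon> + sz c + 2 \<le> N" by (simp add: N_def data_size_def)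
  then have bnds: "bounded N (\<epsilon> / 2)" "bounded N (c + \<epsilon> / 2)" "bounded N 2"
    using assms bounded_half[of "sz \<epsilon>" \<epsilon>] bounded_add[of "sz c" c "sz \<epsilon> + 1" "\<epsilon> / 2"] bounded_2
    by (auto intro: bounded_mono)
  note sizes = bnds[THEN size_le]
  have start: "st 0 = load ?x"
    by (auto simp: st_def s_def load_def fun_eq_iff)
  have "steps sz (2 * N + 2) (While capped_guard capped_body) (st 0)
      (tnodes capped_guard + length rs * (tnodes capped_guard + nodes capped_body)) (st (length rs))"
  proof (rule steps_While)
    fix k assume k: "k < length rs"
    have "run capped_body (st k) = st (Suc k)"
      using k by (auto simp: capped_value_defs st_def s_def machine_simps fun_eq_iff nth_append)
    moreover have "fits sz (2 * N + 2) capped_body (st k)"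
      using k size elem[of "rs ! k"] sums[of k] sums[of "Suc k"]
      by (simp add: capped_value_defs st_def s_def machine_simps nth_append)
    ultimately show "tval capped_guard (st k) \<and> tfits sz (2 * N + 2) capped_guard (st k) \<and>
        fits sz (2 * N + 2) capped_body (st k) \<and> run capped_body (st k) = st (Suc k)"
      using k size by (simp add: capped_value_defs st_def s_def machine_simps)
  qed (use size in \<open>simp_all add: capped_value_defs st_def s_def machine_simps\<close>)
  moreover have "fits sz (2 * N + 2) capped_finish (st (length rs))"
    using size sums[of "length rs"] elem[of \<epsilon>] elem[of c] sizes
    by (simp add: capped_value_defs st_def s_def machine_simps nth_append)
  ultimately show "steps sz (2 * data_size sz ?x + 2) capped_value (load ?x)
      (tnodes capped_guard + length rs * (tnodes capped_guard + nodes capped_body) + nodes capped_finish)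
      (run capped_finish (st (length rs)))"
    unfolding capped_value_def start N_def by (rule steps_Seq[OF _ steps_run])
  show "tnodes capped_guard + length rs * (tnodes capped_guard + nodes capped_body) + nodes capped_finish
      \<le> 60 * (data_size sz ?x + 1)"
    using size by (simp add: capped_value_defs N_def)
  have total: "(\<Sum>j<length rs. rs ! j) = sum_list rs"
    by (simp add: sum_list_sum_nth atLeast0LessThan)
  then show "unload (run capped_finish (st (length rs))) = ([], [min (c + \<epsilon> / 2) (sum_list rs)])"
    by (auto simp: capped_value_defs st_def s_def machine_simps unload_def nth_append)
  show "sz r \<le> 2 * data_size sz ?x + 2"
    if "r \<in> set (snd ([], [min (c + \<epsilon> / 2) (sum_list rs)]))" for r
    using that sums[of "length rs"] sizes total by (auto simp: N_def min_def split: if_splits)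
qed (use data_size_length[of xs "rs @ [\<epsilon>, c]" sz] in simp_all)

text \<open>The matrix \<open>rs\<close> is in row-major order. Stopping at position \<open>k\<close> describes the sums while the pass over the
  matrix is under way; the complete sums have \<open>k = n * n\<close>.\<close>

definition column_sum :: "real list \<Rightarrow> nat \<Rightarrow> nat \<Rightarrow> nat \<Rightarrow> real" where
  "column_sum rs n k j = (\<Sum>i<k. if i mod n = j then rs ! i else 0)"

text \<open>The entries of the matrix of modified weights for the norm \<open>\<infinity>\<close>. The positions divisible by \<open>n + 1\<close> are those on
  the diagonal.\<close>

definition capped_entry :: "real list \<Rightarrow> nat \<Rightarrow> real \<Rightarrow> nat \<Rightarrow> real" where
  "capped_entry rs n \<epsilon> k =
    (if k mod (n + 1) = 0 then rs ! k else min (rs ! k + \<epsilon>) (column_sum rs n (n * n) (k mod n)))"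

text \<open>The matrix is processed in two passes, the first of which computes the column sums. As there is no division
  with remainder for indices, the position \<open>k\<close> (counter 0) is accompanied by \<open>k mod n\<close> (counter 1),
  which gives the column, and in the second pass by \<open>k mod (n + 1)\<close> (counter 2), which is 0 on
  the diagonal.\<close>

abbreviation "dimension \<equiv> IArr 0 (IConst 0)"
abbreviation "entry \<equiv> RArr 0 (counter 0)"
abbreviation "set_entry \<equiv> RAssign 0 (counter 0)"
abbreviation "entry_column_sum \<equiv> RArr 1 (counter 1)"
abbreviation "raised_entry \<equiv> RAdd entry (RArr 0 last_pos)"

definition entry_guard :: test where
  "entry_guard = ILess (counter 0) last_pos"

definition advance :: com where
  "advance = Seq (set_counter 0 (IAdd (counter 0) (IConst 1)))
    (If (ILess (IAdd (counter 1) (IConst 1)) dimension)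
      (set_counter 1 (IAdd (counter 1) (IConst 1))) (set_counter 1 (IConst 0)))"

definition sum_body :: com where
  "sum_body = Seq (RAssign 1 (counter 1) (RAdd entry_column_sum entry)) advance"

definition rewind :: com where
  "rewind = set_counter 0 (IConst 0)"

definition cap_entry :: com where
  "cap_entry = If (ILess (IConst 0) (counter 2))
    (If (RLess entry_column_sum raised_entry) (set_entry entry_column_sum) (set_entry raised_entry))
    Skip"

definition advance_diagonal :: com where
  "advance_diagonal = If (ILess (counter 2) dimension)
    (set_counter 2 (IAdd (counter 2) (IConst 1))) (set_counter 2 (IConst 0))"

definition cap_body :: com where
  "cap_body = Seq cap_entry (Seq advance advance_diagonal)"

definition cap_matrix :: com where
  "cap_matrix = Seq (While entry_guard sum_body) (Seq rewind (Seq (While entry_guard cap_body) drop_real))"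

lemmas cap_matrix_defs = cap_matrix_def entry_guard_def advance_def sum_body_def rewind_def
  cap_entry_def advance_diagonal_def cap_body_def drop_real_def

lemma run_advance:
  assumes "0 < n" "fst s 0 0 = n" "fst s 2 0 = k" "fst s 2 (Suc 0) = k mod n"
  shows "run advance s = iupd 2 1 (Suc k mod n) (iupd 2 0 (Suc k) s)"
proof -
  define r where "r = k mod n"
  have "r < n" "Suc k mod n = (if Suc r = n then 0 else Suc r)"
    using assms(1) by (simp_all add: r_def mod_Suc)
  then show ?thesis using assms(2-4)[folded r_def] by (auto simp: advance_def iupd_def)
qed

lemma fits_advance:
  assumes "n \<le> V" "Suc k \<le> V" "fst s 0 0 = n" "fst s 2 0 = k" "fst s 2 (Suc 0) = k mod n" "0 < n"
  shows "fits sz V advance s"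
proof -
  define r where "r = k mod n"
  have "r < n" using assms(6) by (simp add: r_def)
  then show ?thesis using assms(1-5)[folded r_def] by (simp add: advance_def iupd_def nat_size_leI)
qed

lemma run_advance_diagonal:
  assumes "fst s 0 0 = n" "fst s 2 2 = k mod (n + 1)"
  shows "run advance_diagonal s = iupd 2 2 (Suc k mod (n + 1)) s"
proof -
  define r where "r = k mod (n + 1)"
  have "r < n + 1" "Suc k mod (n + 1) = (if r = n then 0 else Suc r)"
    by (simp_all add: r_def mod_Suc)
  then show ?thesis using assms[folded r_def] by (auto simp: advance_diagonal_def iupd_def)
qed

lemma fits_advance_diagonal:
  assumes "n < V" "2 \<le> V" "fst s 0 0 = n" "fst s 2 2 = k mod (n + 1)"
  shows "fits sz V advance_diagonal s"
proof -
  define r where "r = k mod (n + 1)"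
  have "r < n + 1" by (simp add: r_def)
  then show ?thesis using assms[folded r_def] by (simp add: advance_diagonal_def iupd_def nat_size_leI)
qed

lemma (in size_measure) transforms_cap_matrix:
  assumes bnd: "\<forall>r\<in>set (rs @ [\<epsilon>]). bounded (sz r) r" and "0 < n" and len: "length rs = n * n"
  shows "transforms 200 sz cap_matrix ([n], rs @ [\<epsilon>]) ([n], map (capped_entry rs n \<epsilon>) [0..<n * n])"
proof (rule transformsI)
  let ?x = "([n], rs @ [\<epsilon>])"
  define N where "N = data_size sz ?x"
  define s where "s = load ?x"
  \<comment> \<open>The states after \<open>k\<close> iterations of the first and the second loop.\<close>
  define st1 where "st1 = (\<lambda>k. (\<lambda>a i. if a = 2 \<and> i = 0 then k else if a = 2 \<and> i = 1 then k mod n else fst s a i,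
    \<lambda>a i. if a = 1 then column_sum rs n k i else snd s a i))"
  define st2 where "st2 = (\<lambda>k. (\<lambda>a i. if a = 2 \<and> i = 0 then k else if a = 2 \<and> i = 1 then k mod n
      else if a = 2 \<and> i = 2 then k mod (n + 1) else fst s a i,
    \<lambda>a i. if a = 1 then column_sum rs n (n * n) i else if a = 0 \<and> i < k then capped_entry rs n \<epsilon> i
      else snd s a i))"
  have size: "n * n + 2 \<le> N" "n \<le> N"
  proof -
    show "n * n + 2 \<le> N" using data_size_length[of "[n]" "rs @ [\<epsilon>]" sz] len by (simp add: N_def)
    then show "n \<le> N" using le_square[of n] by linarith
  qed
  have elem: "sz r \<le> 2 * N + 2" if "r \<in> set (rs @ [\<epsilon>])" for r
    using data_size_real[OF that, of sz "[n]"] by (simp add: N_def)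
  have sums: "sz (column_sum rs n k j) \<le> 2 * N + 2" if "k \<le> n * n" for k j
  proof -
    have "column_sum rs n k j = (\<Sum>i\<in>{i \<in> {..<k}. i mod n = j}. rs ! i)"
      unfolding column_sum_def by (rule sum.inter_filter[symmetric]) simp
    also have "\<dots> = (\<Sum>i\<in>{i \<in> {..<k}. i mod n = j}. (rs @ [\<epsilon>]) ! i)"
      using that len by (intro sum.cong) (auto simp: nth_append)
    finally have sum_eq: "column_sum rs n k j = \<dots>" .
    have "bounded N \<dots>" unfolding N_def using that len by (intro bounded_subsum bnd) auto
    then show ?thesis unfolding sum_eq by (rule size_le)
  qed
  have raised: "sz (rs ! k + \<epsilon>) \<le> 2 * N + 2" if "k < n * n" for k
  proof -
    \<comment> \<open>The number \<open>\<epsilon>\<close> is stored behind the matrix, at position \<open>n * n\<close>.\<close>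
    have "bounded N (\<Sum>i\<in>{k, n * n}. (rs @ [\<epsilon>]) ! i)"
      unfolding N_def using that len by (intro bounded_subsum bnd) auto
    then show ?thesis using size_le that len by (simp add: nth_append)
  qed
  have small: "k mod n < n" "k mod Suc n < Suc n" for k using \<open>0 < n\<close> by simp_all
  have small': "k mod n \<le> N" "k mod Suc n \<le> N" for k
    using small[of k] size(2) by linarith+
  have start1: "st1 0 = load ?x"
    by (auto simp: st1_def s_def load_def fun_eq_iff column_sum_def)
  have sums_Suc: "column_sum rs n (Suc k) j = column_sum rs n k j + (if k mod n = j then rs ! k else 0)" for k j
    by (simp add: column_sum_def)
  have loop1: "steps sz (2 * N + 2) (While entry_guard sum_body) (st1 0)
      (tnodes entry_guard + (n * n) * (tnodes entry_guard + nodes sum_body)) (st1 (n * n))"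
  proof (rule steps_While)
    fix k assume k: "k < n * n"
    then have nth: "rs ! k \<in> set (rs @ [\<epsilon>])" using len by simp
    let ?s = "rupd 1 (k mod n) (column_sum rs n k (k mod n) + rs ! k) (st1 k)"
    have sum_run: "run (RAssign 1 (counter 1) (RAdd entry_column_sum entry)) (st1 k) = ?s"
      using k len by (simp add: st1_def s_def machine_simps nth_append)
    have ctrs: "fst ?s 0 0 = n" "fst ?s 2 0 = k" "fst ?s 2 (Suc 0) = k mod n"
      by (simp_all add: st1_def s_def machine_simps)
    have "run sum_body (st1 k) = iupd 2 1 (Suc k mod n) (iupd 2 0 (Suc k) ?s)"
      unfolding sum_body_def run.simps(4) sum_run by (rule run_advance[OF \<open>0 < n\<close> ctrs])
    also have "\<dots> = st1 (Suc k)"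
      by (auto simp: st1_def iupd_def rupd_def fun_eq_iff sums_Suc)
    finally have "run sum_body (st1 k) = st1 (Suc k)" .
    moreover have "fits sz (2 * N + 2) advance ?s"
      using k size by (intro fits_advance[OF _ _ ctrs \<open>0 < n\<close>]) linarith+
    then have "fits sz (2 * N + 2) sum_body (st1 k)"
      unfolding sum_body_def fits.simps(4) sum_run
      using k size len elem[OF nth] sums[of k] sums[of "Suc k" "k mod n"] small[of k] small'[of k]
      by (simp add: st1_def s_def machine_simps nth_append sums_Suc)
    moreover have "tval entry_guard (st1 k)" "tfits sz (2 * N + 2) entry_guard (st1 k)"
      using k size len by (simp_all add: entry_guard_def st1_def s_def machine_simps)
    ultimately show "tval entry_guard (st1 k) \<and> tfits sz (2 * N + 2) entry_guard (st1 k) \<and>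
        fits sz (2 * N + 2) sum_body (st1 k) \<and> run sum_body (st1 k) = st1 (Suc k)"
      by blast
  qed (use size len in \<open>simp_all add: entry_guard_def st1_def s_def machine_simps\<close>)
  have start2: "run rewind (st1 (n * n)) = st2 0"
    by (auto simp: cap_matrix_defs st1_def st2_def s_def machine_simps fun_eq_iff)
  have rewind_fits: "fits sz (2 * N + 2) rewind (st1 (n * n))"
    by (simp add: cap_matrix_defs machine_simps)
  have loop2: "steps sz (2 * N + 2) (While entry_guard cap_body) (st2 0)
      (tnodes entry_guard + (n * n) * (tnodes entry_guard + nodes cap_body)) (st2 (n * n))"
  proof (rule steps_While)
    fix k assume k: "k < n * n"
    then have nth: "rs ! k \<in> set (rs @ [\<epsilon>])" using len by simp
    let ?s = "rupd 0 k (capped_entry rs n \<epsilon> k) (st2 k)"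
    let ?t = "iupd 2 1 (Suc k mod n) (iupd 2 0 (Suc k) ?s)"
    have vals: "fst (st2 k) 0 0 = n" "fst (st2 k) (Suc 0) (Suc 0) = Suc (n * n)" "fst (st2 k) 2 0 = k"
      "fst (st2 k) 2 (Suc 0) = k mod n" "fst (st2 k) 2 2 = k mod (n + 1)"
      "snd (st2 k) 0 k = rs ! k" "snd (st2 k) 0 (n * n) = \<epsilon>"
      "snd (st2 k) (Suc 0) j = column_sum rs n (n * n) j" for j
      using k len by (simp_all add: st2_def s_def load_def nth_append)
    have "rupd 0 k (rs ! k) (st2 k) = st2 k"
      unfolding rupd_def vals(6)[symmetric] by simp
    then have cap_run: "run cap_entry (st2 k) = ?s"
      by (simp add: cap_entry_def capped_entry_def vals min_def)
    have ctrs: "fst ?s 0 0 = n" "fst ?s 2 0 = k" "fst ?s 2 (Suc 0) = k mod n"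
      and ctrs': "fst ?t 0 0 = n" "fst ?t 2 2 = k mod (n + 1)"
      using vals by (simp_all add: iupd_def rupd_def)
    have advance_run: "run advance ?s = ?t" by (rule run_advance[OF \<open>0 < n\<close> ctrs])
    have "run cap_body (st2 k) = iupd 2 2 (Suc k mod (n + 1)) ?t"
      unfolding cap_body_def run.simps(4) cap_run advance_run by (rule run_advance_diagonal[OF ctrs'])
    also have "\<dots> = st2 (Suc k)"
      by (auto simp: st2_def iupd_def rupd_def fun_eq_iff)
    finally have cap_body_run: "run cap_body (st2 k) = st2 (Suc k)" .
    have "fits sz (2 * N + 2) cap_entry (st2 k)"
      using k size elem[OF nth] elem[of \<epsilon>] raised[OF k] sums[of "n * n" "k mod n"] small[of k] small'[of k]
      by (simp add: cap_entry_def vals nat_size_leI)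
    moreover have "fits sz (2 * N + 2) advance ?s"
      using k size by (intro fits_advance[OF _ _ ctrs \<open>0 < n\<close>]) linarith+
    moreover have "fits sz (2 * N + 2) advance_diagonal ?t"
      using k size by (intro fits_advance_diagonal[OF _ _ ctrs']) linarith+
    ultimately have "fits sz (2 * N + 2) cap_body (st2 k)"
      unfolding cap_body_def fits.simps(4) cap_run advance_run by blast
    moreover have "tval entry_guard (st2 k)" "tfits sz (2 * N + 2) entry_guard (st2 k)"
      using k size len by (simp_all add: entry_guard_def st2_def s_def machine_simps)
    ultimately show "tval entry_guard (st2 k) \<and> tfits sz (2 * N + 2) entry_guard (st2 k) \<and>
        fits sz (2 * N + 2) cap_body (st2 k) \<and> run cap_body (st2 k) = st2 (Suc k)"
      using cap_body_run by blast
  qed (use size len in \<open>simp_all add: entry_guard_def st2_def s_def machine_simps\<close>)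
  have finish_fits: "fits sz (2 * N + 2) drop_real (st2 (n * n))"
    using size len by (simp add: cap_matrix_defs st2_def s_def machine_simps)
  show "steps sz (2 * data_size sz ?x + 2) cap_matrix (load ?x)
      ((tnodes entry_guard + (n * n) * (tnodes entry_guard + nodes sum_body)) + (nodes rewind +
       ((tnodes entry_guard + (n * n) * (tnodes entry_guard + nodes cap_body)) + nodes drop_real)))
      (run drop_real (st2 (n * n)))"
    unfolding cap_matrix_def N_def[symmetric]
    using steps_Seq[OF loop1 steps_Seq[OF steps_run[OF rewind_fits, unfolded start2]
        steps_Seq[OF loop2 steps_run[OF finish_fits]]]] unfolding start1 .
  show "(tnodes entry_guard + (n * n) * (tnodes entry_guard + nodes sum_body)) + (nodes rewind +
       ((tnodes entry_guard + (n * n) * (tnodes entry_guard + nodes cap_body)) + nodes drop_real))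
      \<le> 200 * (data_size sz ?x + 1)"
    unfolding N_def[symmetric] using size(1) by (simp add: cap_matrix_defs)
  show "unload (run drop_real (st2 (n * n))) = ([n], map (capped_entry rs n \<epsilon>) [0..<n * n])"
    using len by (auto simp: cap_matrix_defs st2_def s_def machine_simps unload_def)
  show "length (snd ([n], map (capped_entry rs n \<epsilon>) [0..<n * n])) \<le> data_size sz ?x"
    unfolding N_def[symmetric] using size by simp
  show "length (fst ([n], map (capped_entry rs n \<epsilon>) [0..<n * n])) \<le> data_size sz ?x"
    unfolding N_def[symmetric] using size by simp
  show "nat_size a \<le> 2 * data_size sz ?x + 2"
    if "a \<in> set (fst ([n], map (capped_entry rs n \<epsilon>) [0..<n * n]))" for a
    unfolding N_def[symmetric] using size that by (simp add: nat_size_leI)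
  show "sz r \<le> 2 * data_size sz ?x + 2"
    if r: "r \<in> set (snd ([n], map (capped_entry rs n \<epsilon>) [0..<n * n]))" for r
  proof -
    obtain k where k: "k < n * n" "r = capped_entry rs n \<epsilon> k" using r by auto
    then show ?thesis
      using raised[of k] sums[of "n * n"] elem[of "rs ! k"] len
      by (auto simp: capped_entry_def min_def simp flip: N_def)
  qed
qed

section \<open>Weight matrices\<close>

lemma row_major:
  assumes "0 < n"
  shows "concat (map (\<lambda>u. map (f u) [0..<n]) [0..<m]) = map (\<lambda>k. f (k div n) (k mod n)) [0..<m * n]"
proof (induction m)
  case (Suc m)
  have "map (\<lambda>k. f (k div n) (k mod n)) [m * n..<m * n + n] = map (f m) [0..<n]"
    using assms by (intro nth_equalityI) auto
  moreover have "[0..<Suc m * n] = [0..<m * n] @ [m * n..<m * n + n]"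
    using upt_add_eq_append[of 0 "m * n" n] by (simp add: add.commute)
  ultimately show ?case using Suc.IH by simp
qed simp

lemma weight_matrix_row_major:
  assumes "0 < n"
  shows "weight_matrix n w = map (\<lambda>k. if k div n = k mod n then 0 else w (k div n, k mod n)) [0..<n * n]"
  unfolding weight_matrix_def
  using row_major[OF assms, where m = n and f = "\<lambda>u v. if u = v then 0 else w (u, v)"] by (simp add: map_concat comp_def)

lemma length_weight_matrix: "0 < n \<Longrightarrow> length (weight_matrix n w) = n * n"
  by (simp add: weight_matrix_row_major)

lemma sum_row_major:
  fixes f :: "nat \<Rightarrow> nat \<Rightarrow> real"
  assumes "0 < n"
  shows "(\<Sum>k<m * n. f (k div n) (k mod n)) = (\<Sum>u<m. \<Sum>v<n. f u v)"
proof -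
  have "(\<Sum>k<m * n. f (k div n) (k mod n)) = sum_list (concat (map (\<lambda>u. map (f u) [0..<n]) [0..<m]))"
    unfolding row_major[OF assms] by (simp add: interv_sum_list_conv_sum_set_nat atLeast0LessThan)
  also have "\<dots> = (\<Sum>u<m. \<Sum>v<n. f u v)"
    by (induction m) (simp_all add: interv_sum_list_conv_sum_set_nat atLeast0LessThan)
  finally show ?thesis .
qed

lemma sum_list_weight_matrix:
  assumes "0 < n"
  shows "sum_list (weight_matrix n w) = sum w (arcs (complete_on n))"
proof -
  have "sum_list (weight_matrix n w) = (\<Sum>u<n. \<Sum>v<n. if u = v then 0 else w (u, v))"
    unfolding weight_matrix_row_major[OF assms] sum_row_major[OF assms, symmetric]
    by (simp add: interv_sum_list_conv_sum_set_nat atLeast0LessThan)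
  also have "\<dots> = (\<Sum>(u, v)\<in>{..<n} \<times> {..<n}. if u = v then 0 else w (u, v))"
    by (simp add: sum.cartesian_product)
  also have "\<dots> = (\<Sum>(u, v)\<in>arcs (complete_on n). w (u, v))"
    by (rule sum.mono_neutral_cong_right) (auto simp: complete_on_def)
  finally show ?thesis by simp
qed

lemma inflow_complete_on:
  assumes "v < n"
  shows "inflow (complete_on n) w v = (\<Sum>u<n. if u = v then 0 else w (u, v))"
proof -
  have "in_arcs (complete_on n) v = (\<lambda>u. (u, v)) ` ({..<n} - {v})"
    using assms by (auto simp: in_arcs_def complete_on_def)
  then have "inflow (complete_on n) w v = (\<Sum>u\<in>{..<n} - {v}. w (u, v))"
    by (simp add: inflow_def sum.reindex inj_on_def)
  also have "\<dots> = (\<Sum>u<n. if u = v then 0 else w (u, v))"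
    by (rule sum.mono_neutral_cong_left) auto
  finally show ?thesis .
qed

lemma column_sum_weight_matrix:
  assumes "v < n"
  shows "column_sum (weight_matrix n w) n (n * n) v = inflow (complete_on n) w v"
proof -
  have "0 < n" using assms by simp
  have "column_sum (weight_matrix n w) n (n * n) v
      = (\<Sum>k<n * n. if k mod n = v then if k div n = k mod n then 0 else w (k div n, k mod n) else 0)"
    unfolding column_sum_def weight_matrix_row_major[OF \<open>0 < n\<close>] by (intro sum.cong) auto
  also have "\<dots> = (\<Sum>u<n. \<Sum>v'<n. if v' = v then if u = v' then 0 else w (u, v') else 0)"
    by (rule sum_row_major[OF \<open>0 < n\<close>])
  finally show ?thesis using assms by (simp add: inflow_complete_on)
qed

text \<open>For \<open>k = q * n + r\<close> with \<open>q, r < n\<close> we have \<open>k + q = q * (n + 1) + r\<close>, so \<open>k\<close> is congruent to \<open>r - q\<close> modulo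
  \<open>n + 1\<close>.\<close>

lemma diagonal_position:
  fixes n :: nat
  assumes "k < n * n"
  shows "k mod (n + 1) = 0 \<longleftrightarrow> k div n = k mod n"
proof -
  have "0 < n" using assms by (cases n) auto
  have less: "k div n < n + 1" "k mod n < n + 1"
    using assms \<open>0 < n\<close> less_mult_imp_div_less[of k n n] mod_less_divisor[of n k] by linarith+
  have shifted: "k + k div n = (n + 1) * (k div n) + k mod n"
    using div_mult_mod_eq[of k n] by (simp add: algebra_simps)
  show ?thesis
  proof
    assume "k mod (n + 1) = 0"
    then have "(k div n) mod (n + 1) = (k + k div n) mod (n + 1)"
      by (metis add.left_neutral mod_add_left_eq)
    also have "\<dots> = (k mod n) mod (n + 1)" by (simp only: shifted mod_mult_self4)
    finally show "k div n = k mod n" using less by simp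
  next
    assume "k div n = k mod n"
    then have "k = (n + 1) * (k div n)" using shifted by simp
    then show "k mod (n + 1) = 0" by (metis mod_mult_self1_is_0)
  qed
qed

definition capped_weight :: "nat \<Rightarrow> (nat \<times> nat \<Rightarrow> real) \<Rightarrow> real \<Rightarrow> nat \<times> nat \<Rightarrow> real" where
  "capped_weight n w \<epsilon> e = min (w e + \<epsilon>) (inflow (complete_on n) w (snd e))"

lemma weight_matrix_capped_weight:
  assumes "0 < n"
  shows "map (capped_entry (weight_matrix n w) n \<epsilon>) [0..<n * n] = weight_matrix n (capped_weight n w \<epsilon>)"
proof (rule nth_equalityI)
  fix k assume "k < length (map (capped_entry (weight_matrix n w) n \<epsilon>) [0..<n * n])"
  then have k: "k < n * n" by simp
  have entry: "weight_matrix n w' ! k = (if k div n = k mod n then 0 else w' (k div n, k mod n))" for w'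
    using k by (simp add: weight_matrix_row_major[OF assms])
  show "map (capped_entry (weight_matrix n w) n \<epsilon>) [0..<n * n] ! k
      = weight_matrix n (capped_weight n w \<epsilon>) ! k"
    using k assms by (simp add: entry capped_entry_def diagonal_position[OF k, simplified]
        column_sum_weight_matrix capped_weight_def)
qed (simp add: length_weight_matrix assms)

section \<open>The reductions\<close>

lemma weighted_ham_cycle_complete_on:
  assumes "weights_ok n w" "H \<in> ham_cycles (complete_on n)"
  shows "weighted_ham_cycle (complete_on n) w H"
  using assms fin_digraph_complete_on[of n]
  by (simp add: weighted_ham_cycle_def weighted_ham_cycle_axioms_def weights_ok_def)

text \<open>All reductions keep the graph. Hence solutions can be passed on unchanged, and the only computation
  for them is to strip off the rest of the input.\<close>

lemma reducible_same_solutions: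
  assumes "\<And>x. x \<in> instances P \<Longrightarrow> f x \<in> instances Q"
    and "poly_time (instances P) (encode P) (\<lambda>x. encode Q (f x))"
    and "poly_time (instances P)
      (\<lambda>x. data_append (encode P x) ([], [optimum Q (f x)])) (\<lambda>x. ([], [optimum P x]))"
    and "\<And>x t. x \<in> instances P \<Longrightarrow> optimal Q (f x) t \<Longrightarrow> optimal P x t"
    and "sol_words P = sol_words Q"
    and header: "\<And>x. x \<in> instances P \<Longrightarrow> length (fst (encode P x)) = 1"
  shows "reducible P Q"
proof -
  let ?X = "{(x, v). x \<in> instances P \<and> (\<exists>t. optimal Q (f x) t \<and> v \<in> sol_words Q t)}"
  have "poly_time ?X (\<lambda>(x, v). data_append (encode P x) (v, [])) (\<lambda>(x, v). (v, []))"
  proof (rule poly_timeI[where c = drop_first_nat and C = 40])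
    fix sz y assume "y \<in> ?X"
    then obtain x v where y: "y = (x, v)" "x \<in> instances P" by auto
    obtain n rs where "encode P x = ([n], rs)"
      using header[OF y(2)] by (cases "encode P x") (auto simp: length_Suc_conv)
    then show "transforms 40 sz drop_first_nat (case y of (x, v) \<Rightarrow> data_append (encode P x) (v, []))
        (case y of (x, v) \<Rightarrow> (v, []))"
      using transforms_drop_first_nat[of sz n v rs] by (simp add: y data_append_def)
  qed
  then show ?thesis
    unfolding reducible_def using assms(1-5)
    by (intro exI[of _ f] exI[of _ "\<lambda>x v. v"]) auto
qed

text \<open>If the costs of all solutions are preserved, then so is the optimal value. It is the last number of the
  input, and only has to be selected.\<close>

lemma reducible_same_objective:
  assumes inst: "\<And>x. x \<in> instances P \<Longrightarrow> f x \<in> instances Q"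
    and "poly_time (instances P) (encode P) (\<lambda>x. encode Q (f x))"
    and sol: "\<And>x. x \<in> instances P \<Longrightarrow> solutions Q (f x) = solutions P x"
    and obj: "\<And>x s. x \<in> instances P \<Longrightarrow> s \<in> solutions P x \<Longrightarrow> objective Q (f x) s = objective P x s"
    and "sol_words P = sol_words Q"
    and "\<And>x. x \<in> instances P \<Longrightarrow> length (fst (encode P x)) = 1"
  shows "reducible P Q"
proof (rule reducible_same_solutions[where f = f])
  have opt: "optimum Q (f x) = optimum P x" if "x \<in> instances P" for x
    using sol[OF that] obj[OF that] by (simp add: optimum_def cong: image_cong)
  show "poly_time (instances P)
      (\<lambda>x. data_append (encode P x) ([], [optimum Q (f x)])) (\<lambda>x. ([], [optimum P x]))"
  proof (rule poly_timeI[where c = select_last and C = 20])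
    fix sz x assume "x \<in> instances P"
    then show "transforms 20 sz select_last (data_append (encode P x) ([], [optimum Q (f x)]))
        ([], [optimum P x])"
      using opt[of x] by (cases "encode P x") (simp add: data_append_def transforms_select_last)
  qed
  show "optimal Q (f x) t \<Longrightarrow> optimal P x t" if "x \<in> instances P" for x t
    using sol[OF that] obj[OF that] by (auto simp: optimal_def)
qed (use assms in blast)+

lemma reducible_TSP_DiffRTSP:
  assumes "(a, p) \<in> {(Variant_S, Norm_Inf), (Variant_S, Norm_1), (Variant_L, Norm_1)}"
  shows "reducible TSP (DiffRTSP a p)"
proof (rule reducible_same_objective[where f = "\<lambda>(n, w). (n, w, 0)"])
  show "objective (DiffRTSP a p) ((\<lambda>(n, w). (n, w, 0)) x) H = objective TSP x H"
    if "x \<in> instances TSP" "H \<in> solutions TSP x" for x H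
    using that weighted_ham_cycle.worst_cost_radius_0[OF weighted_ham_cycle_complete_on assms]
    by (auto simp: TSP_def DiffRTSP_def)
  show "poly_time (instances TSP) (encode TSP) (\<lambda>x. encode (DiffRTSP a p) ((\<lambda>(n, w). (n, w, 0)) x))"
    by (rule poly_timeI[where c = append_0 and C = 20])
      (auto simp: TSP_def DiffRTSP_def intro: size_measure.transforms_append_0)
qed (auto simp: TSP_def DiffRTSP_def)

lemma reducible_DiffRTSP_S_Norm_Inf:
  "reducible (DiffRTSP Variant_S Norm_Inf) TSP"
proof (rule reducible_same_objective[where f = "\<lambda>(n, w, \<epsilon>). (n, capped_weight n w \<epsilon>)"])
  let ?P = "DiffRTSP Variant_S Norm_Inf" and ?f = "\<lambda>(n, w, \<epsilon>). (n, capped_weight n w \<epsilon>)"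
  show "objective TSP (?f x) H = objective ?P x H"
    if "x \<in> instances ?P" "H \<in> solutions ?P x" for x H
  proof -
    obtain n w \<epsilon> where x: "x = (n, w, \<epsilon>)" by (cases x)
    have "head (complete_on n) = snd" by (simp add: complete_on_def)
    then show ?thesis
      using that weighted_ham_cycle.worst_cost_S_Norm_Inf[OF weighted_ham_cycle_complete_on, of n w H \<epsilon>]
      by (simp add: x TSP_def DiffRTSP_def capped_weight_def[abs_def])
  qed
  show "?f x \<in> instances TSP" if "x \<in> instances ?P" for x
  proof -
    obtain n w \<epsilon> where x: "x = (n, w, \<epsilon>)" by (cases x)
    then have "2 \<le> n" "weights_ok n w" "0 \<le> \<epsilon>" using that by (auto simp: DiffRTSP_def)
    moreover from this have "0 \<le> inflow (complete_on n) w v" for v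
      unfolding inflow_def by (intro sum_nonneg) (auto simp: weights_ok_def)
    ultimately show ?thesis by (auto simp: x TSP_def weights_ok_def capped_weight_def)
  qed
  show "poly_time (instances ?P) (encode ?P) (\<lambda>x. encode TSP (?f x))"
  proof (rule poly_timeI[where c = cap_matrix and C = 200])
    fix sz bounded x
    assume sz: "size_measure sz bounded" and inst: "x \<in> instances ?P"
      and small: "\<forall>r\<in>set (snd (encode ?P x)). bounded (sz r) r"
    obtain n w \<epsilon> where x: "x = (n, w, \<epsilon>)" by (cases x)
    then have n: "0 < n" using inst by (auto simp: DiffRTSP_def)
    show "transforms 200 sz cap_matrix (encode ?P x) (encode TSP (?f x))"
      using size_measure.transforms_cap_matrix[OF sz _ n length_weight_matrix[OF n], of w \<epsilon>] small
      by (simp add: x DiffRTSP_def TSP_def weight_matrix_capped_weight[OF n])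
  qed
qed (auto simp: TSP_def DiffRTSP_def)

text \<open>The instance is mapped to itself without \<open>\<epsilon>\<close>. Costs are transformed by a nondecreasing function, which
  commutes with the minimum over the nonempty finite set of cycles.\<close>

lemma reducible_DiffRTSP_Norm_1:
  "reducible (DiffRTSP a Norm_1) TSP"
proof (rule reducible_same_solutions[where f = "\<lambda>(n, w, \<epsilon>). (n, w)"])
  let ?P = "DiffRTSP a Norm_1" and ?f = "\<lambda>(n, w, \<epsilon> :: real). (n, w)"
  let ?cap = "\<lambda>n w \<epsilon> c. min (c + \<epsilon> / 2) (sum w (arcs (complete_on n)))"
  have obj: "objective ?P (n, w, \<epsilon>) H = ?cap n w \<epsilon> (objective TSP (n, w) H)"
    if "(n, w, \<epsilon>) \<in> instances ?P" "H \<in> ham_cycles (complete_on n)" for n w \<epsilon> H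
    using that weighted_ham_cycle.worst_cost_Norm_1[OF weighted_ham_cycle_complete_on]
    by (simp add: TSP_def DiffRTSP_def)
  have sol: "solutions ?P (n, w, \<epsilon>) = ham_cycles (complete_on n)"
    "solutions TSP (n, w) = ham_cycles (complete_on n)" for n w \<epsilon>
    by (simp_all add: TSP_def DiffRTSP_def)
  show "optimal ?P x t" if inst: "x \<in> instances ?P" and opt: "optimal TSP (?f x) t" for x t
  proof -
    obtain n w \<epsilon> where x: "x = (n, w, \<epsilon>)" by (cases x)
    have "?cap n w \<epsilon> (objective TSP (n, w) t) \<le> ?cap n w \<epsilon> (objective TSP (n, w) s)"
      if "s \<in> ham_cycles (complete_on n)" for s
      using opt that unfolding optimal_def x by (intro min.mono add_right_mono) (auto simp: sol)
    then show ?thesis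
      using opt inst unfolding optimal_def x by (auto simp: sol obj)
  qed
  have opt: "optimum ?P (n, w, \<epsilon>) = ?cap n w \<epsilon> (optimum TSP (n, w))"
    if "(n, w, \<epsilon>) \<in> instances ?P" for n w \<epsilon>
  proof -
    have "2 \<le> n" using that by (simp add: DiffRTSP_def)
    have "objective ?P (n, w, \<epsilon>) ` ham_cycles (complete_on n)
        = ?cap n w \<epsilon> ` objective TSP (n, w) ` ham_cycles (complete_on n)"
      unfolding image_image using obj[OF that] by (intro image_cong) auto
    moreover have "mono (?cap n w \<epsilon>)" by (intro monoI min.mono add_right_mono) auto
    ultimately show ?thesis
      unfolding optimum_def sol
      using mono_Min_commute[of "?cap n w \<epsilon>" "objective TSP (n, w) ` ham_cycles (complete_on n)"]
        fin_digraph.finite_ham_cycles[OF fin_digraph_complete_on[of n]]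
        ham_cycles_complete_on_nonempty[OF \<open>2 \<le> n\<close>] by simp
  qed
  show "poly_time (instances ?P) (encode ?P) (\<lambda>x. encode TSP (?f x))"
    by (rule poly_timeI[where c = drop_real and C = 20])
      (auto simp: TSP_def DiffRTSP_def intro: transforms_drop_real)
  show "poly_time (instances ?P)
      (\<lambda>x. data_append (encode ?P x) ([], [optimum TSP (?f x)])) (\<lambda>x. ([], [optimum ?P x]))"
  proof (rule poly_timeI[where c = capped_value and C = 60])
    fix sz bounded x
    let ?inp = "\<lambda>x. data_append (encode ?P x) ([], [optimum TSP (?f x)])"
    assume sz: "size_measure sz bounded" and inst: "x \<in> instances ?P"
      and small: "\<forall>r\<in>set (snd (?inp x)). bounded (sz r) r"
    obtain n w \<epsilon> where x: "x = (n, w, \<epsilon>)" by (cases x)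
    then have "0 < n" using inst by (auto simp: DiffRTSP_def)
    have inp: "?inp x = ([n], weight_matrix n w @ [\<epsilon>, optimum TSP (n, w)])"
      by (simp add: x DiffRTSP_def data_append_def)
    show "transforms 60 sz capped_value (?inp x) ([], [optimum ?P x])"
      using size_measure.transforms_capped_value[OF sz, of "weight_matrix n w" \<epsilon> "optimum TSP (n, w)" "[n]"]
        small inst opt[of n w \<epsilon>]
      unfolding inp by (simp add: x sum_list_weight_matrix[OF \<open>0 < n\<close>])
  qed
qed (auto simp: TSP_def DiffRTSP_def)

theorem theorem3p1:
  fixes a :: variant and p :: norm_kind
  assumes "(a, p) \<in> {(Variant_S, Norm_Inf), (Variant_S, Norm_1), (Variant_L, Norm_1)}"
  shows "poly_time_equivalent (DiffRTSP a p) TSP \<and>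
    (\<forall>n (G :: ('v, 'e) pre_digraph) w.
       2 \<le> n \<and> complete_digraph n G \<and> (\<forall>e\<in>arcs G. 0 \<le> w e) \<longrightarrow>
         (\<forall>H\<in>ham_cycles G. worst_cost w (uncertainty_set a p G w 0) H = (\<Sum>e\<in>H. w e)) \<and>
         rtsp_opt G w (uncertainty_set a p G w 0) = tsp_opt G w) \<and>
    reducible (DiffRTSP a p) TSP"
proof -
  have to_TSP: "reducible (DiffRTSP a p) TSP"
    using assms reducible_DiffRTSP_S_Norm_Inf reducible_DiffRTSP_Norm_1 by blast
  have "(\<forall>H\<in>ham_cycles G. worst_cost w (uncertainty_set a p G w 0) H = (\<Sum>e\<in>H. w e)) \<and>
      rtsp_opt G w (uncertainty_set a p G w 0) = tsp_opt G w"
    if "complete_digraph n G" "\<forall>e\<in>arcs G. 0 \<le> w e" for n and G :: "('v, 'e) pre_digraph" and w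
  proof -
    have "fin_digraph G"
      using that(1) graph.axioms(1) digraph.axioms(1) unfolding complete_digraph_def by blast
    then have "worst_cost w (uncertainty_set a p G w 0) H = sum w H" if "H \<in> ham_cycles G" for H
      using that \<open>\<forall>e\<in>arcs G. 0 \<le> w e\<close>
      by (intro weighted_ham_cycle.worst_cost_radius_0[OF _ assms])
        (simp add: weighted_ham_cycle_def weighted_ham_cycle_axioms_def)
    then show ?thesis by (simp add: rtsp_opt_def tsp_opt_def cong: image_cong)
  qed
  then show ?thesis
    unfolding poly_time_equivalent_def using to_TSP reducible_TSP_DiffRTSP[OF assms] by blast
qed

end
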